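(* Let $(\epsilon^\pm,\mathsf n^\pm,c^\pm)$ be a pair of Sevostyanov triples and $V$ a finite-dimensional $U_v(\mathfrak g)$-representation. Then: (a) $\tilde{\mathbf D}_V(\tilde J)=\mathrm{tr}_V\bigl(v^{2(\lambda+\rho)}\bigr)\cdot\tilde J$. (b) $\mathbf D_V(J)=\mathrm{tr}_V\bigl(v^{2(\lambda+\rho)}\bigr)\cdot J$.
   Context: **Lie data.** $\mathfrak g$ is a complex semisimple Lie algebra of rank $n$ with simple roots $\alpha_i$, fundamental weights $\omega_i$, weight lattice $P$, root lattice $Q$, $Q_+=\bigoplus\mathbb Z_{\ge0}\alpha_i$, $\rho=\sum\omega_i$. The invariant form is normalized so that $\mathsf d_i=(\alpha_i,\alpha_i)/2$ equals $1$ for short roots; $a_{ij}=2(\alpha_i,\alpha_j)/(\alpha_i,\alpha_i)$, $b_{ij}=(\alpha_i,\alpha_j)$, $v_i=v^{\mathsf d_i}$, $\omega_i^\vee=\omega_i/\mathsf d_i$ (so $(\alpha_j,\omega_i^\vee)=\delta_{ij}$). Fix $N\in\mathbb Z_{>0}$ with $(P,P)\subset\frac1N\mathbb Z$. **Quantum group.** $U_v(\mathfrak g)$ is the $\mathbb C(v^{1/N})$-algebra generated by $E_i,F_i,K_\mu$ ($\mu\in P$) with $K_\mu K_{\mu'}=K_{\mu+\mu'}$, $K_0=1$, $K_\mu E_iK_\mu^{-1}=v^{(\mu,\alpha_i)}E_i$, $K_\mu F_iK_\mu^{-1}=v^{-(\mu,\alpha_i)}F_i$, $[E_i,F_j]=\delta_{ij}\frac{K_{\alpha_i}-K_{\alpha_i}^{-1}}{v_i-v_i^{-1}}$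 and the $v$-Serre relations; $L_i=K_{\omega_i}$. $U_{v^{-1}}(\mathfrak g)$ is the analogous algebra with $v\to v^{-1}$, with generators $\bar E_i,\bar F_i,\bar K_\mu$, $\bar L_i=\bar K_{\omega_i}$. Finite-dimensional modules have weights in $P$. **Sevostyanov triples.** A triple $(\epsilon,\mathsf n,c)$: $\epsilon$ is the matrix of an orientation of the simple graph underlying the Dynkin diagram ($\epsilon_{ij}=1$ if $i\to j$, $-1$ if $i\leftarrow j$, $0$ if $i=j$ or $a_{ij}=0$); $\mathsf n$ is an integer $n\times n$ matrix with $\mathsf d_j\mathsf n_{ij}-\mathsf d_i\mathsf n_{ji}=\epsilon_{ij}b_{ij}$; $c=(c_i)$ are nonzero scalars (here in $\mathsf k^\times$). Put $\nu_i^\pm=\sum_k\mathsf n^\pm_{ik}\omega_k\in P$. **Verma modules, Whittaker vectors.** $\mathsf k=\mathbb C(v^{1/N},u_1,\dots,u_n)$ with $u_i$ indeterminates; $\lambda$ is a formal symbol with $v^{(\lambda,\sum m_i\omega_i)}:=\prod u_i^{m_i}$. $\mathcal V$ is the universal Verma $U_v(\mathfrak g)$-module over $\mathsf k$ generated by $\mathbf 1$ with $E_i\mathbf 1=0$, $L_i\mathbf 1=u_i\mathbf 1$; $\mathcal V=\bigoplus_{\beta\in Q_+}\mathcal V_\beta$ with $K_\mu=v^{(\mu,\lambda-\beta)}$ on $\mathcal V_\beta$. $\bar{\mathcal V}$ is the universal Verma $U_{v^{-1}}(\mathfrak g)$-module generated by $\bar{\mathbf 1}$ with $\bar E_i\bar{\mathbf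 1}=0$, $\bar L_i\bar{\mathbf 1}=u_i^{-1}\bar{\mathbf 1}$, with $\bar K_\mu=v^{-(\mu,\lambda-\beta)}$ on $\bar{\mathcal V}_\beta$. There is a unique nondegenerate $\mathsf k$-bilinear pairing $\mathcal V\times\bar{\mathcal V}\to\mathsf k$ with $(\mathbf 1,\bar{\mathbf 1})=1$, $(xw,w')=(w,\sigma(x)w')$, where $\sigma:U_v(\mathfrak g)\to U_{v^{-1}}(\mathfrak g)$ is the anti-isomorphism $E_i\mapsto\bar F_i$, $F_i\mapsto\bar E_i$, $L_i\mapsto\bar L_i^{-1}$. $\theta=\sum\theta_\beta\in\prod\mathcal V_\beta$ and $\bar\theta=\sum\bar\theta_\beta\in\prod\bar{\mathcal V}_\beta$ are the unique vectors with $\theta_0=\mathbf 1$, $E_iK_{\nu_i^+}(\theta)=c_i^+\theta$, $\bar\theta_0=\bar{\mathbf 1}$, $\bar E_i\bar K_{\nu_i^-}(\bar\theta)=c_i^-\bar\theta$ for all $i$. Put $J_\beta=(\theta_\beta,\bar\theta_\beta)$. **Generating functions.** Write $\underline y^{\beta-\lambda}=\prod_iy_i^{(\beta-\lambda,\omega_i^\vee)}$ (formal symbols), and similarly with $\lambda+\rho$ in place of $\lambda$. $N_\lambda$ is the space of formal sums $\sum_{\beta\in Q}a_\beta\underline y^{\beta-\lambda}$, $a_\beta\in\mathsf k$, for which there is $\beta_0\in Q$ with $a_\beta=0$ unless $\beta-\beta_0\in Q_+$; $N_{\lambda+\rho}$ is defined analogously. Set $$\tilde J=\sum_{\beta\in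 Q_+}J_\beta\,\underline y^{\beta-\lambda}\in N_\lambda,\qquad J=\sum_{\beta\in Q_+}J_\beta\,\underline y^{\beta-\lambda-\rho}\in N_{\lambda+\rho}.$$ **Difference operators.** $\mathcal D_v(H^{\mathrm{ad}})$ (scalars extended to $\mathsf k$) has basis $e^\alpha T_\mu$ ($\alpha\in Q,\mu\in P$), with $T_\mu e^\alpha=v^{(\mu,\alpha)}e^\alpha T_\mu$. It acts on $N_\lambda$ by $T_\mu(\underline y^{\beta-\lambda})=v^{-(\mu,\beta-\lambda)}\underline y^{\beta-\lambda}$, $e^\alpha(\underline y^{\beta-\lambda})=\underline y^{\beta-\alpha-\lambda}$, and on $N_{\lambda+\rho}$ analogously with $\lambda$ replaced by $\lambda+\rho$. Put $e_i=E_i\prod_pL_p^{\mathsf n^+_{ip}}$, $f_i=\prod_pL_p^{-\mathsf n^-_{ip}}F_i$, let $U^+_{\mathsf n^+},U^-_{\mathsf n^-}$ be the subalgebras generated by the $e_i$, resp. $f_i$, and $\chi^\pm$ their characters with $\chi^+(e_i)=c_i^+$, $\chi^-(f_i)=c_i^-$. Let $Y\mapsto\tilde{\mathbf D}_Y$ be the linear map $U_v(\mathfrak g)\to\mathcal D_v(H^{\mathrm{ad}})$ with $fK_\mu e\mapsto\chi^-(f)\chi^+(e)e^{-\beta}T_\mu$ for $e\in U^+_{\mathsf n^+}$ and $f\in U^-_{\mathsf n^-}$ of weight $-\beta$. (Equivalently $(Y\phi)|_H=\tilde{\mathbf D}_Y(\phi|_H)$ for all Whittaker functions $\phi$, i.e.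 $(\chi^-,\chi^+)$-semi-invariants in the completed quantized coordinate ring of the big Bruhat cell.) $C_V=\mathrm{tr}_V(\mathrm{id}\otimes\pi_V)(R^{\mathrm{op}}R(1\otimes K_{2\rho}))$ ($R$ the universal $R$-matrix) is the unique central element acting on the Verma module of highest weight $\lambda$ by $\mathrm{tr}_V(v^{2(\lambda+\rho)}):=\sum_kv^{2(\lambda+\rho,\mu_k)}$, where $\mu_k\in P$ are the weights of $V$ with multiplicity. $\tilde{\mathbf D}_V=\tilde{\mathbf D}_{C_V}$ and $\mathbf D_V=e^\rho\tilde{\mathbf D}_Ve^{-\rho}$ (with $e^\rho T_\mu e^{-\rho}=v^{-(\mu,\rho)}T_\mu$). *)

theory Defs
  imports
    "HOL-Analysis.Analysis"
    "HOL-Library.Poly_Mapping"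
    "HOL-Computational_Algebra.Polynomial"
    "HOL-Computational_Algebra.Fraction_Field"
begin

section \<open>Lie data\<close>

text \<open>
  A complex semisimple Lie algebra of rank \<open>CARD('n)\<close> enters through its Cartan matrix
  \<open>cart L i j = a\<^sub>i\<^sub>j\<close>, the half square lengths \<open>symd L i = d\<^sub>i\<close> of the simple roots,
  and the integer \<open>den L = N\<close>.
  Elements of the weight lattice \<open>P\<close> are integer vectors of coordinates in the fundamental
  weights; elements of the root lattice \<open>Q\<close> are integer vectors of coordinates in the simple
  roots.  Both lattices are thus represented by integer vectors, and \<open>Q_to_P\<close> is the inclusion.
\<close>

type_synonym 'n Plat = "(int, 'n) vec"
type_synonym 'n Qlat = "(int, 'n) vec"

record 'n lie_data =
  cart :: "'n \<Rightarrow> 'n \<Rightarrow> int"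
  symd :: "'n \<Rightarrow> int"
  den :: nat

definition root_form :: "'n::finite lie_data \<Rightarrow> 'n \<Rightarrow> 'n \<Rightarrow> int" where
  "root_form L i j = symd L i * cart L i j"

definition Q_to_P :: "'n::finite lie_data \<Rightarrow> 'n Qlat \<Rightarrow> 'n Plat" where
  "Q_to_P L \<beta> = (\<chi> k. \<Sum>i\<in>UNIV. \<beta> $ i * cart L k i)"

definition sroot :: "'n::finite \<Rightarrow> 'n Qlat" where
  "sroot i = axis i 1"

definition fweight :: "'n::finite \<Rightarrow> 'n Plat" where
  "fweight i = axis i 1"

definition \<rho> :: "'n::finite Plat" where
  "\<rho> = (\<Sum>i\<in>UNIV. fweight i)"

definition Q_plus :: "'n::finite Qlat set" where
  "Q_plus = {\<beta>. \<forall>i. 0 \<le> \<beta> $ i}"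

text \<open>
  The Gram matrix \<open>G\<close> of the fundamental weights is the solution of
  \<open>\<Sum>\<^sub>k a\<^sub>k\<^sub>i G\<^sub>k\<^sub>j = (\<alpha>\<^sub>i, \<omega>\<^sub>j) = d\<^sub>i \<delta>\<^sub>i\<^sub>j\<close>.
\<close>

definition wt_gram :: "'n::finite lie_data \<Rightarrow> rat ^ 'n ^ 'n" where
  "wt_gram L =
     matrix_inv (\<chi> i k. of_int (cart L k i)) ** (\<chi> i j. if i = j then of_int (symd L i) else 0)"

definition wt_form :: "'n::finite lie_data \<Rightarrow> 'n Plat \<Rightarrow> 'n Plat \<Rightarrow> rat" where
  "wt_form L \<mu> \<nu> = (\<Sum>i\<in>UNIV. \<Sum>j\<in>UNIV. of_int (\<mu> $ i) * wt_gram L $ i $ j * of_int (\<nu> $ j))"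

text \<open>
  The last two conditions say that every simple component has a simple root with \<open>d = 1\<close>
  (hence its short roots have \<open>d = 1\<close>) and that \<open>(P,P)\<close> lies in \<open>(1/N)\<int>\<close>.
\<close>

definition semisimple_data :: "'n::finite lie_data \<Rightarrow> bool" where
  "semisimple_data L \<longleftrightarrow>
     (\<forall>i. cart L i i = 2) \<and>
     (\<forall>i j. i \<noteq> j \<longrightarrow> cart L i j \<le> 0) \<and>
     (\<forall>i. 0 < symd L i) \<and>
     (\<forall>i j. root_form L i j = root_form L j i) \<and>
     (\<forall>x :: 'n \<Rightarrow> real. (\<exists>i. x i \<noteq> 0) \<longrightarrow>
        0 < (\<Sum>i\<in>UNIV. \<Sum>j\<in>UNIV. x i * of_int (root_form L i j) * x j)) \<and>
     (\<forall>i. \<exists>j. (i, j) \<in> {(k, l). cart L k l \<noteq> 0}\<^sup>* \<and> symd L j = 1) \<and>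
     0 < den L \<and> (\<forall>\<mu> \<nu>. of_nat (den L) * wt_form L \<mu> \<nu> \<in> \<int>)"


section \<open>Ground fields\<close>

text \<open>
  \<open>Cq\<close> is \<open>\<complex>(v\<^bsup>1/N\<^esup>)\<close> and \<open>'n kfield\<close> is \<open>k = \<complex>(v\<^bsup>1/N\<^esup>)(u\<^sub>1,\<dots>,u\<^sub>n)\<close>; the linear order on the index
  type is only needed by the library to see that polynomial rings are integral domains.
\<close>

type_synonym Cq = "complex poly fract"
type_synonym 'n kfield = "(('n \<Rightarrow>\<^sub>0 nat) \<Rightarrow>\<^sub>0 Cq) fract"

definition vroot :: Cq where
  "vroot = Fract [:0, 1:] 1"

definition \<iota> :: "Cq \<Rightarrow> 'n::{finite,linorder} kfield" where
  "\<iota> c = Fract (Poly_Mapping.single 0 c) 1"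

definition uvar :: "'n::{finite,linorder} \<Rightarrow> 'n kfield" where
  "uvar i = Fract (Poly_Mapping.single (Poly_Mapping.single i 1) 1) 1"

text \<open>
  In what follows \<open>q\<close> stands for the chosen \<open>N\<close>-th root of the quantum parameter and
  \<open>vpow L q r\<close> for \<open>v\<^bsup>r\<^esup>\<close> with \<open>r \<in> (1/N)\<int>\<close>.  The parameter \<open>v\<^bsup>-1\<^esup>\<close> is obtained by inverting \<open>q\<close>.
\<close>

definition vpow :: "'n::finite lie_data \<Rightarrow> 'c::field \<Rightarrow> rat \<Rightarrow> 'c" where
  "vpow L q r = q powi \<lfloor>of_nat (den L) * r\<rfloor>"

text \<open>\<open>v\<^bsup>(\<lambda>,\<mu>)\<^esup>\<close>, where \<open>v\<^bsup>(\<lambda>,\<omega>\<^sub>i)\<^esup> = u i\<close>.\<close>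

definition vlam :: "('n::finite \<Rightarrow> 'c::field) \<Rightarrow> 'n Plat \<Rightarrow> 'c" where
  "vlam u \<mu> = (\<Prod>i\<in>UNIV. u i powi (\<mu> $ i))"


section \<open>The quantum group\<close>

datatype 'n::finite gen = GE 'n | GF 'n | GK "'n Plat"

datatype 'n::finite gword = GW "'n gen list"

instantiation gword :: (finite) monoid_add
begin

definition zero_gword :: "'a gword" where "0 = GW []"

fun plus_gword :: "'a gword \<Rightarrow> 'a gword \<Rightarrow> 'a gword" where
  "GW xs + GW ys = GW (xs @ ys)"

instance
proof
  fix a b c :: "'a gword"
  show "a + b + c = a + (b + c)" by (cases a; cases b; cases c) simp
  show "0 + a = a" by (cases a) (simp add: zero_gword_def)
  show "a + 0 = a" by (cases a) (simp add: zero_gword_def)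
qed

end

text \<open>
  The free associative algebra over a field on \<open>E\<^sub>i, F\<^sub>i, K\<^sub>\<mu>\<close>: finitely supported functions on
  words with the convolution product.  Elements of \<open>U\<^sub>v\<close> are represented by elements
  of the free algebra, equality in \<open>U\<^sub>v\<close> being congruence modulo the two-sided ideal \<open>uq_ideal\<close>
  generated by the defining relations.
\<close>

type_synonym ('n, 'c) free_alg = "'n gword \<Rightarrow>\<^sub>0 'c"

definition cst :: "'c::field \<Rightarrow> ('n::finite, 'c) free_alg" where
  "cst c = Poly_Mapping.single 0 c"

definition gE :: "'n::finite \<Rightarrow> ('n, 'c::field) free_alg" where
  "gE i = Poly_Mapping.single (GW [GE i]) 1"

definition gF :: "'n::finite \<Rightarrow> ('n, 'c::field) free_alg" where
  "gF i = Poly_Mapping.single (GW [GF i]) 1"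

definition gK :: "'n::finite Plat \<Rightarrow> ('n, 'c::field) free_alg" where
  "gK \<mu> = Poly_Mapping.single (GW [GK \<mu>]) 1"

text \<open>Gaussian binomial coefficient with respect to \<open>[m] = (x\<^bsup>m\<^esup> - x\<^bsup>-m\<^esup>) / (x - x\<^bsup>-1\<^esup>)\<close>.\<close>

definition qbinom :: "'c::field \<Rightarrow> nat \<Rightarrow> nat \<Rightarrow> 'c" where
  "qbinom x m r =
     (\<Prod>s=1..r. (x powi (int m - int s + 1) - x powi - (int m - int s + 1)) /
               (x powi int s - x powi - int s))"

definition serre :: "'n::finite lie_data \<Rightarrow> 'c::field \<Rightarrow> ('n \<Rightarrow> ('n, 'c) free_alg)
    \<Rightarrow> 'n \<Rightarrow> 'n \<Rightarrow> ('n, 'c) free_alg" where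
  "serre L q X i j =
     (let m = nat (1 - cart L i j) in
      \<Sum>r\<le>m. cst ((-1) ^ r * qbinom (vpow L q (of_int (symd L i))) m r)
              * X i ^ (m - r) * X j * X i ^ r)"

definition uq_relators :: "'n::finite lie_data \<Rightarrow> 'c::field \<Rightarrow> ('n, 'c) free_alg set" where
  "uq_relators L q =
     {gK \<mu> * gK \<nu> - gK (\<mu> + \<nu>) | \<mu> \<nu>. True}
   \<union> {gK 0 - 1}
   \<union> {gK \<mu> * gE i * gK (- \<mu>) - cst (vpow L q (wt_form L \<mu> (Q_to_P L (sroot i)))) * gE i | \<mu> i. True}
   \<union> {gK \<mu> * gF i * gK (- \<mu>) - cst (vpow L q (- wt_form L \<mu> (Q_to_P L (sroot i)))) * gF i | \<mu> i. True}
   \<union> {gE i * gF j - gF j * gE i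
       - (if i = j
          then cst (1 / (vpow L q (of_int (symd L i)) - inverse (vpow L q (of_int (symd L i)))))
               * (gK (Q_to_P L (sroot i)) - gK (- Q_to_P L (sroot i)))
          else 0) | i j. True}
   \<union> {serre L q gE i j | i j. i \<noteq> j}
   \<union> {serre L q gF i j | i j. i \<noteq> j}"

inductive_set uq_ideal :: "'n::finite lie_data \<Rightarrow> 'c::field \<Rightarrow> ('n, 'c) free_alg set"
  for L q where
  zero: "0 \<in> uq_ideal L q"
| gen: "r \<in> uq_relators L q \<Longrightarrow> x * r * y \<in> uq_ideal L q"
| add: "x \<in> uq_ideal L q \<Longrightarrow> y \<in> uq_ideal L q \<Longrightarrow> x + y \<in> uq_ideal L q"

text \<open>The subalgebra of \<open>U\<^sub>v\<close> generated by the classes of \<open>S\<close>, as a union of congruence classes.\<close>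

inductive_set uq_subalg ::
  "'n::finite lie_data \<Rightarrow> 'c::field \<Rightarrow> ('n, 'c) free_alg set \<Rightarrow> ('n, 'c) free_alg set"
  for L q S where
  const: "cst c \<in> uq_subalg L q S"
| gen: "x \<in> S \<Longrightarrow> x \<in> uq_subalg L q S"
| add: "x \<in> uq_subalg L q S \<Longrightarrow> y \<in> uq_subalg L q S \<Longrightarrow> x + y \<in> uq_subalg L q S"
| mult: "x \<in> uq_subalg L q S \<Longrightarrow> y \<in> uq_subalg L q S \<Longrightarrow> x * y \<in> uq_subalg L q S"
| cong: "x \<in> uq_subalg L q S \<Longrightarrow> y - x \<in> uq_ideal L q \<Longrightarrow> y \<in> uq_subalg L q S"

definition uq_weight :: "'n::finite lie_data \<Rightarrow> 'c::field \<Rightarrow> 'n Qlat \<Rightarrow> ('n, 'c) free_alg \<Rightarrow> bool" where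
  "uq_weight L q \<gamma> x \<longleftrightarrow>
     (\<forall>\<mu>. gK \<mu> * x * gK (- \<mu>) - cst (vpow L q (wt_form L \<mu> (Q_to_P L \<gamma>))) * x \<in> uq_ideal L q)"

definition uq_central :: "'n::finite lie_data \<Rightarrow> 'c::field \<Rightarrow> ('n, 'c) free_alg \<Rightarrow> bool" where
  "uq_central L q z \<longleftrightarrow> (\<forall>x. z * x - x * z \<in> uq_ideal L q)"

definition uq_module :: "'n::finite lie_data \<Rightarrow> 'c::field \<Rightarrow> ('c \<Rightarrow> 'w::ab_group_add \<Rightarrow> 'w)
    \<Rightarrow> (('n, 'c) free_alg \<Rightarrow> 'w \<Rightarrow> 'w) \<Rightarrow> bool" where
  "uq_module L q sc \<pi> \<longleftrightarrow>
     vector_space sc \<and>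
     (\<forall>x. Vector_Spaces.linear sc sc (\<pi> x)) \<and>
     (\<forall>x y w. \<pi> (x + y) w = \<pi> x w + \<pi> y w) \<and>
     (\<forall>x y w. \<pi> (x * y) w = \<pi> x (\<pi> y w)) \<and>
     (\<forall>c w. \<pi> (cst c) w = sc c w) \<and>
     (\<forall>r\<in>uq_relators L q. \<forall>w. \<pi> r w = 0)"


section \<open>Finite-dimensional representations\<close>

definition uq_wt_space :: "'n::finite lie_data \<Rightarrow> 'c::field \<Rightarrow> ('c \<Rightarrow> 'w::ab_group_add \<Rightarrow> 'w)
    \<Rightarrow> (('n, 'c) free_alg \<Rightarrow> 'w \<Rightarrow> 'w) \<Rightarrow> 'n Plat \<Rightarrow> 'w set" where
  "uq_wt_space L q sc \<pi> \<mu> = {w. \<forall>\<nu>. \<pi> (gK \<nu>) w = sc (vpow L q (wt_form L \<nu> \<mu>)) w}"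

definition fd_uq_module :: "'n::finite lie_data \<Rightarrow> 'c::field \<Rightarrow> ('c \<Rightarrow> 'w::ab_group_add \<Rightarrow> 'w)
    \<Rightarrow> (('n, 'c) free_alg \<Rightarrow> 'w \<Rightarrow> 'w) \<Rightarrow> bool" where
  "fd_uq_module L q sc \<pi> \<longleftrightarrow>
     uq_module L q sc \<pi> \<and>
     (\<exists>B. finite B \<and> module.span sc B = UNIV) \<and>
     module.span sc (\<Union>\<mu>. uq_wt_space L q sc \<pi> \<mu>) = UNIV"

text \<open>\<open>tr\<^sub>V(v\<^bsup>2(\<lambda>+\<rho>)\<^esup>)\<close>: the sum over the weights \<open>\<mu>\<close> of \<open>V\<close>, with multiplicity, of \<open>v\<^bsup>2(\<lambda>+\<rho>,\<mu>)\<^esup>\<close>.\<close>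

definition tr_2lam_rho :: "'n::{finite,linorder} lie_data \<Rightarrow> (Cq \<Rightarrow> 'x::ab_group_add \<Rightarrow> 'x)
    \<Rightarrow> (('n, Cq) free_alg \<Rightarrow> 'x \<Rightarrow> 'x) \<Rightarrow> 'n kfield" where
  "tr_2lam_rho L sc \<pi> =
     (\<Sum>\<mu> | uq_wt_space L vroot sc \<pi> \<mu> \<noteq> {0}.
        of_nat (vector_space.dim sc (uq_wt_space L vroot sc \<pi> \<mu>))
        * (vlam uvar (\<mu> + \<mu>) * vpow L (\<iota> vroot) (2 * wt_form L \<rho> \<mu>)))"


section \<open>Sevostyanov triples\<close>

definition sevostyanov_triple ::
  "'n::finite lie_data \<Rightarrow> ('n \<Rightarrow> 'n \<Rightarrow> int) \<Rightarrow> ('n \<Rightarrow> 'n \<Rightarrow> int) \<Rightarrow> ('n \<Rightarrow> 'c::field) \<Rightarrow> bool" where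
  "sevostyanov_triple L \<epsilon> n c \<longleftrightarrow>
     (\<forall>i j. if i = j \<or> cart L i j = 0 then \<epsilon> i j = 0
            else \<epsilon> i j \<in> {1, -1} \<and> \<epsilon> j i = - \<epsilon> i j) \<and>
     (\<forall>i j. symd L j * n i j - symd L i * n j i = \<epsilon> i j * root_form L i j) \<and>
     (\<forall>i. c i \<noteq> 0)"

definition sev_nu :: "('n::finite \<Rightarrow> 'n \<Rightarrow> int) \<Rightarrow> 'n \<Rightarrow> 'n Plat" where
  "sev_nu n i = (\<chi> k. n i k)"


section \<open>Universal Verma modules and Whittaker vectors\<close>

text \<open>
  All notions below are for a parameter \<open>q\<close> and for \<open>v\<^bsup>(\<lambda>,\<omega>\<^sub>i)\<^esup> = u i\<close>; the barred objects, for
  \<open>U\<^sub>v\<close> at \<open>v\<^bsup>-1\<^esup>\<close>, are obtained by inverting both \<open>q\<close> and all \<open>u i\<close>.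
  The Verma module is the quotient of the free algebra over \<open>k\<close> by the left ideal generated by
  the relations of \<open>U\<^sub>v\<close>, the \<open>E\<^sub>i\<close> and the \<open>L\<^sub>i - u\<^sub>i\<close>.
\<close>

inductive_set verma_left_ideal ::
  "'n::finite lie_data \<Rightarrow> 'c::field \<Rightarrow> ('n \<Rightarrow> 'c) \<Rightarrow> ('n, 'c) free_alg set"
  for L q u where
  ideal: "x \<in> uq_ideal L q \<Longrightarrow> x \<in> verma_left_ideal L q u"
| E: "x * gE i \<in> verma_left_ideal L q u"
| L: "x * (gK (fweight i) - cst (u i)) \<in> verma_left_ideal L q u"
| add: "x \<in> verma_left_ideal L q u \<Longrightarrow> y \<in> verma_left_ideal L q u \<Longrightarrow> x + y \<in> verma_left_ideal L q u"

definition universal_verma :: "'n::finite lie_data \<Rightarrow> 'c::field \<Rightarrow> ('n \<Rightarrow> 'c)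
    \<Rightarrow> ('c \<Rightarrow> 'w::ab_group_add \<Rightarrow> 'w) \<Rightarrow> (('n, 'c) free_alg \<Rightarrow> 'w \<Rightarrow> 'w) \<Rightarrow> 'w \<Rightarrow> bool" where
  "universal_verma L q u sc \<pi> one \<longleftrightarrow>
     uq_module L q sc \<pi> \<and>
     (\<forall>w. \<exists>x. w = \<pi> x one) \<and>
     (\<forall>x. \<pi> x one = 0 \<longleftrightarrow> x \<in> verma_left_ideal L q u)"

definition verma_wt_space :: "'n::finite lie_data \<Rightarrow> 'c::field \<Rightarrow> ('n \<Rightarrow> 'c)
    \<Rightarrow> ('c \<Rightarrow> 'w::ab_group_add \<Rightarrow> 'w) \<Rightarrow> (('n, 'c) free_alg \<Rightarrow> 'w \<Rightarrow> 'w) \<Rightarrow> 'n Qlat \<Rightarrow> 'w set" where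
  "verma_wt_space L q u sc \<pi> \<beta> =
     {w. \<forall>\<mu>. \<pi> (gK \<mu>) w = sc (vlam u \<mu> * vpow L q (- wt_form L \<mu> (Q_to_P L \<beta>))) w}"

text \<open>
  An element of \<open>\<Prod>\<^sub>\<beta> V\<^sub>\<beta>\<close> is the family of its components, extended by zero to all of \<open>Q\<close>.
  Since \<open>E\<^sub>i\<close> maps \<open>V\<^sub>\<beta>\<^sub>+\<^sub>\<alpha>\<^sub>i\<close> to \<open>V\<^sub>\<beta>\<close>, the equation \<open>E\<^sub>i K\<^sub>\<nu>\<^sub>i \<theta> = c\<^sub>i \<theta>\<close> reads as follows.
\<close>

definition whittaker_vector :: "'n::finite lie_data \<Rightarrow> 'c::field \<Rightarrow> ('n \<Rightarrow> 'c)
    \<Rightarrow> ('c \<Rightarrow> 'w::ab_group_add \<Rightarrow> 'w) \<Rightarrow> (('n, 'c) free_alg \<Rightarrow> 'w \<Rightarrow> 'w) \<Rightarrow> 'w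
    \<Rightarrow> ('n \<Rightarrow> 'n \<Rightarrow> int) \<Rightarrow> ('n \<Rightarrow> 'c) \<Rightarrow> ('n Qlat \<Rightarrow> 'w) \<Rightarrow> bool" where
  "whittaker_vector L q u sc \<pi> one n c \<theta> \<longleftrightarrow>
     (\<forall>\<beta>. \<theta> \<beta> \<in> verma_wt_space L q u sc \<pi> \<beta>) \<and>
     (\<forall>\<beta>. \<beta> \<notin> Q_plus \<longrightarrow> \<theta> \<beta> = 0) \<and>
     \<theta> 0 = one \<and>
     (\<forall>i \<beta>. \<pi> (gE i * gK (sev_nu n i)) (\<theta> (\<beta> + sroot i)) = sc (c i) (\<theta> \<beta>))"

text \<open>The anti-isomorphism \<open>\<sigma>\<close>, lifted to the free algebras.\<close>

fun sigma_gen :: "'n::finite gen \<Rightarrow> 'n gen" where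
  "sigma_gen (GE i) = GF i"
| "sigma_gen (GF i) = GE i"
| "sigma_gen (GK \<mu>) = GK (- \<mu>)"

fun sigma_word :: "'n::finite gword \<Rightarrow> 'n gword" where
  "sigma_word (GW xs) = GW (rev (map sigma_gen xs))"

definition \<sigma> :: "('n::finite, 'c::field) free_alg \<Rightarrow> ('n, 'c) free_alg" where
  "\<sigma> x = (\<Sum>w\<in>Poly_Mapping.keys x.
            Poly_Mapping.single (sigma_word w) (Poly_Mapping.lookup x w))"

definition verma_pairing ::
  "('c::field \<Rightarrow> 'w::ab_group_add \<Rightarrow> 'w) \<Rightarrow> (('n::finite, 'c) free_alg \<Rightarrow> 'w \<Rightarrow> 'w) \<Rightarrow> 'w
   \<Rightarrow> ('c \<Rightarrow> 'z::ab_group_add \<Rightarrow> 'z) \<Rightarrow> (('n, 'c) free_alg \<Rightarrow> 'z \<Rightarrow> 'z) \<Rightarrow> 'z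
   \<Rightarrow> ('w \<Rightarrow> 'z \<Rightarrow> 'c) \<Rightarrow> bool" where
  "verma_pairing sc \<pi> one scb \<pi>b oneb B \<longleftrightarrow>
     (\<forall>z. Vector_Spaces.linear sc (*) (\<lambda>w. B w z)) \<and>
     (\<forall>w. Vector_Spaces.linear scb (*) (B w)) \<and>
     (\<forall>w. (\<forall>z. B w z = 0) \<longrightarrow> w = 0) \<and>
     (\<forall>z. (\<forall>w. B w z = 0) \<longrightarrow> z = 0) \<and>
     B one oneb = 1 \<and>
     (\<forall>x w z. B (\<pi> x w) z = B w (\<pi>b (\<sigma> x) z))"


section \<open>Generating functions and difference operators\<close>

text \<open>
  A formal sum \<open>\<Sum>\<^sub>\<kappa> \<phi>(\<kappa>) y\<^bsup>\<kappa>-\<lambda>\<^esup>\<close> over \<open>\<kappa> \<in> P\<close> is represented by its coefficient function \<open>\<phi>\<close>, so that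
  \<open>N_space L 0\<close> is \<open>N\<^sub>\<lambda>\<close> and \<open>N_space L \<rho>\<close> is \<open>N\<^sub>\<lambda>\<^sub>+\<^sub>\<rho>\<close>, and \<open>gen_series L s J\<close> is
  \<open>\<Sum>\<^sub>\<beta> J(\<beta>) y\<^bsup>\<beta>-\<lambda>-s\<^esup>\<close> over \<open>\<beta> \<in> Q\<^sub>+\<close>.
\<close>

type_synonym ('n, 'c) series = "'n Plat \<Rightarrow> 'c"

definition N_space :: "'n::finite lie_data \<Rightarrow> 'n Plat \<Rightarrow> ('n, 'c::field) series set" where
  "N_space L s =
     {\<phi>. \<exists>\<beta>0. \<forall>\<kappa>. \<phi> \<kappa> \<noteq> 0 \<longrightarrow> (\<exists>\<beta>. \<kappa> = Q_to_P L \<beta> - s \<and> \<beta> - \<beta>0 \<in> Q_plus)}"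

definition gen_series ::
  "'n::finite lie_data \<Rightarrow> 'n Plat \<Rightarrow> ('n Qlat \<Rightarrow> 'c::field) \<Rightarrow> ('n, 'c) series" where
  "gen_series L s J = (\<lambda>\<kappa>. \<Sum>\<beta> | \<beta> \<in> Q_plus \<and> Q_to_P L \<beta> - s = \<kappa>. J \<beta>)"

lemma gen_series_in_N_space: "gen_series L s J \<in> N_space L s"
proof -
  have "\<exists>\<beta>. \<kappa> = Q_to_P L \<beta> - s \<and> \<beta> - 0 \<in> Q_plus" if "gen_series L s J \<kappa> \<noteq> 0" for \<kappa>
  proof -
    have "{\<beta>. \<beta> \<in> Q_plus \<and> Q_to_P L \<beta> - s = \<kappa>} \<noteq> {}"
      using that unfolding gen_series_def by force
    then show ?thesis by auto
  qed
  then show ?thesis unfolding N_space_def by blast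
qed

text \<open>
  Elements of \<open>D\<^sub>v(H\<^sup>a\<^sup>d)\<close> over \<open>k\<close> are their coordinates in the basis \<open>e\<^bsup>\<alpha>\<^esup> T\<^sub>\<mu>\<close>, indexed by
  \<open>(\<alpha>, \<mu>) \<in> Q \<times> P\<close>.
\<close>

type_synonym ('n, 'c) diff_op = "('n Qlat \<times> 'n Plat) \<Rightarrow>\<^sub>0 'c"

definition act_T :: "'n::finite lie_data \<Rightarrow> 'c::field \<Rightarrow> ('n \<Rightarrow> 'c) \<Rightarrow> 'n Plat
    \<Rightarrow> ('n, 'c) series \<Rightarrow> ('n, 'c) series" where
  "act_T L q u \<mu> \<phi> = (\<lambda>\<kappa>. vlam u \<mu> * vpow L q (- wt_form L \<mu> \<kappa>) * \<phi> \<kappa>)"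

definition act_e :: "'n::finite lie_data \<Rightarrow> 'n Qlat \<Rightarrow> ('n, 'c::field) series \<Rightarrow> ('n, 'c) series" where
  "act_e L \<alpha> \<phi> = (\<lambda>\<kappa>. \<phi> (\<kappa> + Q_to_P L \<alpha>))"

definition act_D :: "'n::finite lie_data \<Rightarrow> 'c::field \<Rightarrow> ('n \<Rightarrow> 'c)
    \<Rightarrow> ('n, 'c) diff_op \<Rightarrow> ('n, 'c) series \<Rightarrow> ('n, 'c) series" where
  "act_D L q u D \<phi> =
     (\<lambda>\<kappa>. \<Sum>(\<alpha>, \<mu>)\<in>Poly_Mapping.keys D.
            Poly_Mapping.lookup D (\<alpha>, \<mu>) * act_e L \<alpha> (act_T L q u \<mu> \<phi>) \<kappa>)"

text \<open>\<open>D \<mapsto> e\<^bsup>\<rho>\<^esup> D e\<^bsup>-\<rho>\<^esup>\<close>, that is \<open>e\<^bsup>\<alpha>\<^esup> T\<^sub>\<mu> \<mapsto> v\<^bsup>-(\<mu>,\<rho>)\<^esup> e\<^bsup>\<alpha>\<^esup> T\<^sub>\<mu>\<close>.\<close>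

definition rho_conj :: "'n::finite lie_data \<Rightarrow> 'c::field \<Rightarrow> ('n, 'c) diff_op \<Rightarrow> ('n, 'c) diff_op" where
  "rho_conj L q D =
     (\<Sum>(\<alpha>, \<mu>)\<in>Poly_Mapping.keys D.
        Poly_Mapping.single (\<alpha>, \<mu>) (vpow L q (- wt_form L \<mu> \<rho>) * Poly_Mapping.lookup D (\<alpha>, \<mu>)))"


section \<open>The map from the quantum group to difference operators\<close>

definition sev_e :: "('n::finite \<Rightarrow> 'n \<Rightarrow> int) \<Rightarrow> 'n \<Rightarrow> ('n, 'c::field) free_alg" where
  "sev_e n i = gE i * gK (sev_nu n i)"

definition sev_f :: "('n::finite \<Rightarrow> 'n \<Rightarrow> int) \<Rightarrow> 'n \<Rightarrow> ('n, 'c::field) free_alg" where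
  "sev_f n i = gK (- sev_nu n i) * gF i"

definition U_plus :: "'n::finite lie_data \<Rightarrow> ('n \<Rightarrow> 'n \<Rightarrow> int) \<Rightarrow> ('n, Cq) free_alg set" where
  "U_plus L n = uq_subalg L vroot (Set.range (sev_e n))"

definition U_minus :: "'n::finite lie_data \<Rightarrow> ('n \<Rightarrow> 'n \<Rightarrow> int) \<Rightarrow> ('n, Cq) free_alg set" where
  "U_minus L n = uq_subalg L vroot (Set.range (sev_f n))"

definition character_on :: "'n::{finite,linorder} lie_data \<Rightarrow> ('n, Cq) free_alg set
    \<Rightarrow> (('n, Cq) free_alg \<Rightarrow> 'n kfield) \<Rightarrow> bool" where
  "character_on L A ch \<longleftrightarrow>
     (\<forall>x\<in>A. \<forall>y\<in>A. x - y \<in> uq_ideal L vroot \<longrightarrow> ch x = ch y) \<and>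
     (\<forall>x\<in>A. \<forall>y\<in>A. ch (x + y) = ch x + ch y \<and> ch (x * y) = ch x * ch y) \<and>
     (\<forall>c. ch (cst c) = \<iota> c)"

definition dscale :: "'c::field \<Rightarrow> ('n::finite, 'c) diff_op \<Rightarrow> ('n, 'c) diff_op" where
  "dscale c D = Poly_Mapping.map ((*) c) D"

text \<open>
  \<open>D\<close> is the map \<open>Y \<mapsto> D\<^sub>Y\<close> (with tilde): a \<open>\<complex>(v\<^bsup>1/N\<^esup>)\<close>-linear map on \<open>U\<^sub>v\<close>, given on the free algebra and
  constant on congruence classes, with \<open>f K\<^sub>\<mu> e \<mapsto> \<chi>\<^sup>-(f) \<chi>\<^sup>+(e) e\<^bsup>-\<beta>\<^esup> T\<^sub>\<mu>\<close> for \<open>f\<close> of weight \<open>-\<beta>\<close>.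
\<close>

definition whittaker_reduction :: "'n::{finite,linorder} lie_data
    \<Rightarrow> ('n \<Rightarrow> 'n \<Rightarrow> int) \<Rightarrow> (('n, Cq) free_alg \<Rightarrow> 'n kfield)
    \<Rightarrow> ('n \<Rightarrow> 'n \<Rightarrow> int) \<Rightarrow> (('n, Cq) free_alg \<Rightarrow> 'n kfield)
    \<Rightarrow> (('n, Cq) free_alg \<Rightarrow> ('n, 'n kfield) diff_op) \<Rightarrow> bool" where
  "whittaker_reduction L np chp nm chm D \<longleftrightarrow>
     (\<forall>x y. x - y \<in> uq_ideal L vroot \<longrightarrow> D x = D y) \<and>
     (\<forall>x y. D (x + y) = D x + D y) \<and>
     (\<forall>c x. D (cst c * x) = dscale (\<iota> c) (D x)) \<and>
     (\<forall>f\<in>U_minus L nm. \<forall>e\<in>U_plus L np. \<forall>\<beta> \<mu>. uq_weight L vroot (- \<beta>) f \<longrightarrow>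
        D (f * gK \<mu> * e) = Poly_Mapping.single (- \<beta>, \<mu>) (chm f * chp e))"

definition extend_scalars :: "('n::{finite,linorder}, Cq) free_alg \<Rightarrow> ('n, 'n kfield) free_alg" where
  "extend_scalars x = Poly_Mapping.map \<iota> x"

text \<open>
  \<open>C\<^sub>V\<close>, characterised as the central element of \<open>U\<^sub>v\<close> acting on the Verma module of
  highest weight \<open>\<lambda>\<close> by \<open>tr\<^sub>V(v\<^bsup>2(\<lambda>+\<rho>)\<^esup>)\<close>.
\<close>

definition is_C_V :: "'n::{finite,linorder} lie_data
    \<Rightarrow> ('n kfield \<Rightarrow> 'w::ab_group_add \<Rightarrow> 'w) \<Rightarrow> (('n, 'n kfield) free_alg \<Rightarrow> 'w \<Rightarrow> 'w)
    \<Rightarrow> (Cq \<Rightarrow> 'x::ab_group_add \<Rightarrow> 'x) \<Rightarrow> (('n, Cq) free_alg \<Rightarrow> 'x \<Rightarrow> 'x)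
    \<Rightarrow> ('n, Cq) free_alg \<Rightarrow> bool" where
  "is_C_V L sc \<pi> scV \<pi>V C \<longleftrightarrow>
     uq_central L vroot C \<and>
     (\<forall>w. \<pi> (extend_scalars C) w = sc (tr_2lam_rho L scV \<pi>V) w)"

end

theory Submission
  imports Defs
begin

text \<open>
  By the triangular decomposition every \<open>x\<close> in \<open>U\<^sub>v\<close> is a linear combination of products \<open>f K\<^sub>\<mu> e\<close> of the
  twisted generators.  Moving \<open>f\<close> to the other side of the pairing, the Whittaker equations and the
  orthogonality of distinct weight spaces identify the component at \<open>\<beta>\<close> of \<open>(x \<theta>, \<theta>b)\<close> with the
  coefficient at \<open>\<beta>\<close> of \<open>D\<^sub>x\<close> applied to the generating series of \<open>J\<close>.  A central \<open>C\<^sub>V\<close> acts on \<open>\<theta>\<close> by a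
  scalar, which gives (a); shifting exponents by \<open>\<rho>\<close> gives (b).  Only the spanning half of the
  triangular decomposition is needed.
\<close>


section \<open>Finitely supported functions\<close>

text \<open>Updating at a fresh key is adding a monomial, so the update induction becomes one in
  which additive statements reduce to monomials.\<close>

lemma poly_mapping_additive_induct [case_names zero single add]:
  fixes p :: "'a \<Rightarrow>\<^sub>0 'b::comm_monoid_add"
  assumes "P 0"
    and "\<And>k c. P (Poly_Mapping.single k c)"
    and "\<And>p p'. P p \<Longrightarrow> P p' \<Longrightarrow> P (p + p')"
  shows "P p"
proof -
  have "P (Poly_Mapping.update k c p)" if "k \<notin> Poly_Mapping.keys p" "P p" for k c and p :: "'a \<Rightarrow>\<^sub>0 'b"
  proof -
    have "Poly_Mapping.update k c p = Poly_Mapping.single k c + p"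
      using that(1)
      by (intro poly_mapping_eqI)
        (auto simp: lookup_update lookup_add lookup_single in_keys_iff when_def)
    then show ?thesis using assms that(2) by simp
  qed
  then show ?thesis using assms(1) by (induction p rule: update_induct) auto
qed

lemma lookup_map_eq:
  "f 0 = 0 \<Longrightarrow> Poly_Mapping.lookup (Poly_Mapping.map f p) k = f (Poly_Mapping.lookup p k)"
  by (simp add: Poly_Mapping.map.rep_eq when_def)

text \<open>The linear functional with prescribed values on the basis. Reading off one coefficient
  of a difference operator applied to a fixed series has this form.\<close>

definition lin_eval :: "('k \<Rightarrow> 'c::comm_semiring_1) \<Rightarrow> ('k \<Rightarrow>\<^sub>0 'c) \<Rightarrow> 'c" where
  "lin_eval g D = (\<Sum>k\<in>Poly_Mapping.keys D. Poly_Mapping.lookup D k * g k)"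

lemma lin_eval_superset:
  assumes "finite A" "Poly_Mapping.keys D \<subseteq> A"
  shows "lin_eval g D = (\<Sum>k\<in>A. Poly_Mapping.lookup D k * g k)"
  unfolding lin_eval_def
  by (rule sum.mono_neutral_left) (use assms in \<open>auto simp: in_keys_iff\<close>)

lemma lin_eval_zero [simp]: "lin_eval g 0 = 0"
  by (simp add: lin_eval_def)

lemma lin_eval_add: "lin_eval g (D + D') = lin_eval g D + lin_eval g D'"
proof -
  let ?A = "Poly_Mapping.keys D \<union> Poly_Mapping.keys D'"
  have "Poly_Mapping.keys (D + D') \<subseteq> ?A" by (rule keys_add)
  then show ?thesis
    by (simp add: lin_eval_superset[of ?A] lookup_add distrib_right sum.distrib)
qed

lemma lin_eval_single [simp]: "lin_eval g (Poly_Mapping.single k c) = c * g k"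
  by (subst lin_eval_superset[of "{k}"]) auto

lemma lin_eval_sum: "lin_eval g (\<Sum>x\<in>A. D x) = (\<Sum>x\<in>A. lin_eval g (D x))"
  by (induction A rule: infinite_finite_induct) (auto simp: lin_eval_add)

lemma lin_eval_dscale: "lin_eval g (dscale c D) = c * lin_eval g D"
proof -
  have "Poly_Mapping.keys (dscale c D) \<subseteq> Poly_Mapping.keys D"
    by (auto simp: dscale_def in_keys_iff lookup_map_eq)
  then show ?thesis
    by (subst lin_eval_superset[of "Poly_Mapping.keys D"])
      (auto simp: lin_eval_def dscale_def lookup_map_eq sum_distrib_left mult.assoc)
qed


section \<open>The ground fields\<close>

lemma Fract_1_eq_0_iff: "Fract a (1 :: 'a::idom) = 0 \<longleftrightarrow> a = 0"
  unfolding Zero_fract_def by (simp add: eq_fract)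

lemma single_eq_0_iff: "Poly_Mapping.single k c = 0 \<longleftrightarrow> c = 0"
  by (metis lookup_single_eq lookup_zero single_zero)

lemma \<iota>_zero [simp]: "\<iota> 0 = 0"
  by (simp add: \<iota>_def fract_collapse)

lemma \<iota>_one [simp]: "\<iota> 1 = 1"
  by (simp add: \<iota>_def fract_collapse)

lemma \<iota>_add: "\<iota> (a + b) = \<iota> a + \<iota> b"
  by (simp add: \<iota>_def single_add)

lemma \<iota>_mult: "\<iota> (a * b) = \<iota> a * \<iota> b"
  by (simp add: \<iota>_def mult_single)

lemma \<iota>_uminus: "\<iota> (- a) = - \<iota> a"
  by (simp add: \<iota>_def single_uminus)

lemma \<iota>_diff: "\<iota> (a - b) = \<iota> a - \<iota> b"
  by (simp add: \<iota>_def single_diff)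

lemma \<iota>_eq_0_iff [simp]: "\<iota> a = 0 \<longleftrightarrow> a = 0"
  by (simp add: \<iota>_def Fract_1_eq_0_iff single_eq_0_iff)

lemma \<iota>_inverse: "\<iota> (inverse a) = inverse (\<iota> a)"
proof (cases "a = 0")
  case False
  then have "\<iota> a * \<iota> (inverse a) = (1 :: 'a kfield)"
    by (simp flip: \<iota>_mult)
  then show ?thesis by (metis inverse_unique)
qed auto

lemma \<iota>_divide: "\<iota> (a / b) = \<iota> a / \<iota> b"
  by (simp add: divide_inverse \<iota>_mult \<iota>_inverse)

lemma \<iota>_power: "\<iota> (a ^ n) = \<iota> a ^ n"
  by (induction n) (auto simp: \<iota>_mult)

lemma \<iota>_powi: "\<iota> (a powi n) = \<iota> a powi n"
  by (simp add: power_int_def \<iota>_power \<iota>_inverse)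

lemma \<iota>_prod: "\<iota> (\<Prod>x\<in>A. f x) = (\<Prod>x\<in>A. \<iota> (f x))"
  by (induction A rule: infinite_finite_induct) (auto simp: \<iota>_mult)

lemma \<iota>_vpow: "\<iota> (vpow L q r) = vpow L (\<iota> q) r"
  by (simp add: vpow_def \<iota>_powi)

lemma \<iota>_qbinom: "\<iota> (qbinom x m r) = qbinom (\<iota> x) m r"
  by (simp add: qbinom_def \<iota>_prod \<iota>_divide \<iota>_diff \<iota>_powi \<iota>_power)

lemma vroot_nonzero [simp]: "vroot \<noteq> 0"
  by (simp add: vroot_def Fract_1_eq_0_iff)

lemma vroot_power: "vroot ^ n = Fract (monom 1 n) 1"
  by (induction n) (auto simp: vroot_def One_fract_def monom_Suc monom_0 one_pCons)

text \<open>Nonnegative powers of \<open>vroot\<close> are monomials, and a monomial equal to 1 has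
  degree 0, as its constant coefficient shows; negative exponents follow by inversion.\<close>

lemma vroot_not_root_of_unity: "vroot powi m = 1 \<longleftrightarrow> m = 0"
proof -
  have *: "n = 0" if "vroot ^ n = 1" for n
  proof -
    have "monom 1 n = (1 :: complex poly)"
      using that by (simp add: vroot_power One_fract_def eq_fract)
    then have "coeff (monom 1 n :: complex poly) 0 = 1"
      by simp
    then show ?thesis by (simp split: if_splits)
  qed
  show ?thesis
    using *[of "nat m"] *[of "nat (- m)"]
    by (auto simp: power_int_def power_inverse split: if_splits)
qed

lemma \<iota>_vroot_not_root_of_unity: "(\<iota> vroot :: 'n::{finite,linorder} kfield) powi m = 1 \<longleftrightarrow> m = 0"
proof -
  have "\<iota> (vroot powi m - 1) = (\<iota> vroot powi m - 1 :: 'n kfield)"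
    by (simp add: \<iota>_diff \<iota>_powi)
  then have "(\<iota> vroot powi m - 1 :: 'n kfield) = 0 \<longleftrightarrow> vroot powi m - 1 = 0"
    by (metis \<iota>_eq_0_iff)
  then show ?thesis by (simp add: vroot_not_root_of_unity)
qed

lemma uvar_nonzero [simp]: "uvar i \<noteq> 0"
  by (simp add: uvar_def Fract_1_eq_0_iff single_eq_0_iff)


section \<open>The weight lattice\<close>

lemma Q_to_P_zero [simp]: "Q_to_P L 0 = 0"
  by (simp add: Q_to_P_def vec_eq_iff)

lemma Q_to_P_add: "Q_to_P L (\<beta> + \<gamma>) = Q_to_P L \<beta> + Q_to_P L \<gamma>"
  by (simp add: Q_to_P_def vec_eq_iff distrib_right sum.distrib)

lemma Q_to_P_uminus: "Q_to_P L (- \<beta>) = - Q_to_P L \<beta>"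
  by (simp add: Q_to_P_def vec_eq_iff sum_negf)

lemma Q_to_P_diff: "Q_to_P L (\<beta> - \<gamma>) = Q_to_P L \<beta> - Q_to_P L \<gamma>"
  by (simp add: Q_to_P_def vec_eq_iff left_diff_distrib sum_subtractf)

lemma wt_form_zero_right [simp]: "wt_form L \<mu> 0 = 0"
  by (simp add: wt_form_def)

lemma wt_form_add_right: "wt_form L \<mu> (\<nu> + \<kappa>) = wt_form L \<mu> \<nu> + wt_form L \<mu> \<kappa>"
  by (simp add: wt_form_def distrib_left sum.distrib)

lemma wt_form_uminus_right: "wt_form L \<mu> (- \<nu>) = - wt_form L \<mu> \<nu>"
  by (simp add: wt_form_def sum_negf)

lemma wt_form_uminus_left: "wt_form L (- \<mu>) \<nu> = - wt_form L \<mu> \<nu>"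
  by (simp add: wt_form_def sum_negf)

text \<open>A kernel vector of the Cartan matrix would be isotropic for the root form, against
  positive definiteness. The transpose appears because \<open>wt_gram\<close> inverts the transposed
  Cartan matrix.\<close>

lemma cartan_matrix_invertible:
  fixes L :: "'n::finite lie_data"
  assumes "semisimple_data L"
  shows "invertible ((\<chi> i k. of_int (cart L k i)) :: rat ^ 'n ^ 'n)" (is "invertible ?A")
proof -
  define M :: "rat ^ 'n ^ 'n" where "M = (\<chi> i k. of_int (cart L i k))"
  have "x = 0" if "M *v x = 0" for x
  proof (rule ccontr)
    assume "x \<noteq> 0"
    \<comment> \<open>Positivity is assumed over the reals, so the rational kernel vector is carried
      there.\<close>
    define y :: "'n \<Rightarrow> real" where "y i = of_rat (x $ i)" for i
    have "(\<Sum>k\<in>UNIV. of_int (cart L i k) * x $ k) = 0" for i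
      using that by (simp add: M_def matrix_vector_mult_def vec_eq_iff)
    then have "of_rat (\<Sum>k\<in>UNIV. of_int (cart L i k) * x $ k) = (0 :: real)" for i
      by simp
    then have y0: "(\<Sum>k\<in>UNIV. of_int (cart L i k) * y k) = 0" for i
      by (simp add: of_rat_sum of_rat_mult y_def)
    have "\<exists>i. y i \<noteq> 0"
      using \<open>x \<noteq> 0\<close> by (auto simp: y_def vec_eq_iff)
    then have "0 < (\<Sum>i\<in>UNIV. \<Sum>j\<in>UNIV. y i * of_int (root_form L i j) * y j)"
      using assms by (auto simp: semisimple_data_def)
    also have "\<dots> = (\<Sum>i\<in>UNIV. y i * of_int (symd L i) * (\<Sum>j\<in>UNIV. of_int (cart L i j) * y j))"
      by (simp add: root_form_def sum_distrib_left mult_ac)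
    also have "\<dots> = 0" by (simp add: y0)
    finally show False by simp
  qed
  then have "invertible (transpose M)"
    by (simp add: invertible_right_inverse right_invertible_transpose matrix_left_invertible_ker)
  moreover have "transpose M = ?A"
    by (simp add: M_def transpose_def vec_eq_iff)
  ultimately show ?thesis by simp
qed

text \<open>With A the transposed Cartan matrix and S the diagonal matrix of the
  \<open>symd L i\<close>, the Gram matrix is the inverse of A times S. Symmetrizability says that S
  times the transpose of A is A S, so the Gram matrix times the transpose of A is S.\<close>

lemma wt_form_fweight_Q_to_P:
  fixes L :: "'n::finite lie_data"
  assumes "semisimple_data L"
  shows "wt_form L (fweight i) (Q_to_P L \<beta>) = of_int (symd L i * \<beta> $ i)"
proof -
  define A :: "rat ^ 'n ^ 'n" where "A = (\<chi> i k. of_int (cart L k i))"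
  define S :: "rat ^ 'n ^ 'n" where "S = (\<chi> i j. if i = j then of_int (symd L i) else 0)"
  have sym: "symd L k * cart L k l = symd L l * cart L l k" for k l
    using assms by (simp add: semisimple_data_def root_form_def)
  have "(S ** transpose A) $ k $ l = (A ** S) $ k $ l" for k l
  proof -
    have "(S ** transpose A) $ k $ l = of_int (symd L k * cart L k l)"
      by (simp add: matrix_matrix_mult_def transpose_def S_def A_def mult_delta_left)
    also have "\<dots> = of_int (symd L l * cart L l k)"
      by (simp only: sym)
    also have "\<dots> = (A ** S) $ k $ l"
      by (simp add: matrix_matrix_mult_def S_def A_def mult_delta_right)
    finally show ?thesis .
  qed
  then have "S ** transpose A = A ** S"
    by (simp add: vec_eq_iff)
  moreover have "matrix_inv A ** A = mat 1"
    using cartan_matrix_invertible[OF assms] unfolding A_def[symmetric] invertible_def matrix_inv_def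
    by (rule someI2_ex) simp
  ultimately have "wt_gram L ** transpose A = S"
    unfolding wt_gram_def A_def[symmetric] S_def[symmetric]
    by (metis matrix_mul_assoc matrix_mul_lid)
  then have G: "(\<Sum>j\<in>UNIV. wt_gram L $ i $ j * of_int (cart L j k)) = S $ i $ k" for k
    by (simp add: vec_eq_iff matrix_matrix_mult_def A_def transpose_def)
  have "wt_form L (fweight i) (Q_to_P L \<beta>)
      = (\<Sum>l\<in>UNIV. if l = i then \<Sum>j\<in>UNIV. wt_gram L $ l $ j * of_int (Q_to_P L \<beta> $ j) else 0)"
    unfolding wt_form_def fweight_def axis_def by (intro sum.cong) auto
  also have "\<dots> = (\<Sum>j\<in>UNIV. wt_gram L $ i $ j * of_int (Q_to_P L \<beta> $ j))"
    by simp
  also have "\<dots> = (\<Sum>j\<in>UNIV. \<Sum>k\<in>UNIV. of_int (\<beta> $ k) * (wt_gram L $ i $ j * of_int (cart L j k)))"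
    by (simp add: Q_to_P_def sum_distrib_left mult_ac)
  also have "\<dots> = (\<Sum>k\<in>UNIV. of_int (\<beta> $ k) * (\<Sum>j\<in>UNIV. wt_gram L $ i $ j * of_int (cart L j k)))"
    by (subst sum.swap) (simp add: sum_distrib_left)
  also have "\<dots> = of_int (symd L i * \<beta> $ i)"
    by (simp add: G S_def mult_delta_right)
  finally show ?thesis .
qed

text \<open>Pairing with the fundamental weights recovers the coordinates up to the positive factors
  \<open>symd L i\<close>.\<close>

lemma inj_Q_to_P:
  assumes "semisimple_data L"
  shows "inj (Q_to_P L)"
proof (rule injI)
  fix \<beta> \<gamma> :: "'a Qlat"
  assume eq: "Q_to_P L \<beta> = Q_to_P L \<gamma>"
  have "(of_int (symd L i * \<beta> $ i) :: rat) = of_int (symd L i * \<gamma> $ i)" for i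
    by (simp only: wt_form_fweight_Q_to_P[OF assms, symmetric] eq)
  then have "symd L i * \<beta> $ i = symd L i * \<gamma> $ i" for i
    by (simp only: of_int_eq_iff)
  moreover have "0 < symd L i" for i
    using assms unfolding semisimple_data_def by blast
  ultimately show "\<beta> = \<gamma>" by (simp add: vec_eq_iff less_le)
qed

section \<open>Powers of \<open>v\<close> and the symbol \<open>v\<close> to the power (\<lambda>,
  \<mu>)\<close>

text \<open>The floor in \<open>vpow\<close> is exact on exponents in (1/N)Z, where the exponential
  law is that of integer powers.\<close>

lemma vpow_add:
  assumes "q \<noteq> 0" "of_nat (den L) * r \<in> \<int>" "of_nat (den L) * s \<in> \<int>"
  shows "vpow L q (r + s) = vpow L q r * vpow L q s"
proof -
  obtain m where m: "of_nat (den L) * r = of_int m"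
    using assms(2) by (rule Ints_cases)
  obtain n where n: "of_nat (den L) * s = of_int n"
    using assms(3) by (rule Ints_cases)
  have "of_nat (den L) * (r + s) = of_int (m + n)"
    by (simp add: distrib_left m n)
  then show ?thesis
    using assms(1) by (simp only: vpow_def m n floor_of_int) (simp add: power_int_add)
qed

lemma vpow_zero [simp]: "vpow L q 0 = 1"
  by (simp add: vpow_def)

lemma vpow_nonzero [simp]: "q \<noteq> 0 \<Longrightarrow> vpow L q r \<noteq> 0"
  by (simp add: vpow_def power_int_eq_0_iff)

lemma vpow_inverse:
  assumes "of_nat (den L) * r \<in> \<int>"
  shows "vpow L (inverse q) r = vpow L q (- r)"
proof -
  obtain m where m: "of_nat (den L) * r = of_int m"
    using assms by (rule Ints_cases)
  then have "of_nat (den L) * - r = of_int (- m)"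
    by simp
  then show ?thesis
    by (simp only: vpow_def m floor_of_int) (simp add: power_int_minus power_int_inverse)
qed

lemma vlam_nonzero: "(\<And>i. u i \<noteq> 0) \<Longrightarrow> vlam u \<mu> \<noteq> 0"
  by (simp add: vlam_def power_int_eq_0_iff)

lemma vlam_inverse: "vlam (\<lambda>i. inverse (u i)) (- \<mu>) = vlam u \<mu>"
  by (simp add: vlam_def power_int_minus power_int_inverse)


section \<open>Triangular spanning set of the quantum group\<close>

lemma cst_zero [simp]: "cst 0 = 0"
  by (simp add: cst_def)

lemma cst_one [simp]: "cst 1 = 1"
  by (simp add: cst_def)

lemma cst_mult: "cst (a * b) = cst a * cst b"
  by (simp add: cst_def mult_single)

lemma cst_mult_single: "cst c * Poly_Mapping.single w d = Poly_Mapping.single w (c * d)"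
  by (simp add: cst_def mult_single)

lemma cst_commute: "x * cst c = cst c * x"
  by (induction x rule: poly_mapping_additive_induct)
    (simp_all add: cst_def mult_single mult.commute distrib_left distrib_right)

lemma cst_left_commute: "x * (cst c * y) = cst c * (x * y)"
  by (metis cst_commute mult.assoc)

text \<open>One rule per family of relators, used both to obtain congruences and to recognise
  relators after extension of scalars.\<close>

lemma uq_relators_intros:
  "gK \<mu> * gK \<nu> - gK (\<mu> + \<nu>) \<in> uq_relators L q"
  "gK 0 - 1 \<in> uq_relators L q"
  "gK \<mu> * gE i * gK (- \<mu>) - cst (vpow L q (wt_form L \<mu> (Q_to_P L (sroot i)))) * gE i \<in> uq_relators L q"
  "gK \<mu> * gF i * gK (- \<mu>) - cst (vpow L q (- wt_form L \<mu> (Q_to_P L (sroot i)))) * gF i \<in> uq_relators L q"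
  "gE i * gF j - gF j * gE i
     - (if i = j
        then cst (1 / (vpow L q (of_int (symd L i)) - inverse (vpow L q (of_int (symd L i)))))
             * (gK (Q_to_P L (sroot i)) - gK (- Q_to_P L (sroot i)))
        else 0) \<in> uq_relators L q"
  "i \<noteq> j \<Longrightarrow> serre L q gE i j \<in> uq_relators L q"
  "i \<noteq> j \<Longrightarrow> serre L q gF i j \<in> uq_relators L q"
  subgoal unfolding uq_relators_def by (rule UnI1, rule UnI1, rule UnI1, rule UnI1, rule UnI1, rule UnI1, rule CollectI, intro exI conjI, rule refl, rule TrueI)
  subgoal unfolding uq_relators_def by (rule UnI1, rule UnI1, rule UnI1, rule UnI1, rule UnI1, rule UnI2, rule singletonI)
  subgoal unfolding uq_relators_def by (rule UnI1, rule UnI1, rule UnI1, rule UnI1, rule UnI2, rule CollectI, intro exI conjI, rule refl, rule TrueI)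
  subgoal unfolding uq_relators_def by (rule UnI1, rule UnI1, rule UnI1, rule UnI2, rule CollectI, intro exI conjI, rule refl, rule TrueI)
  subgoal unfolding uq_relators_def by (rule UnI1, rule UnI1, rule UnI2, rule CollectI, intro exI conjI, rule refl, rule TrueI)
  subgoal unfolding uq_relators_def by (rule UnI1, rule UnI2, rule CollectI, intro exI conjI, rule refl)
  subgoal unfolding uq_relators_def by (rule UnI2, rule CollectI, intro exI conjI, rule refl)
  done

locale quantum_group =
  fixes L :: "'n::finite lie_data" and q :: "'c::field"
  assumes q_nonzero: "q \<noteq> 0"
    and integral: "of_nat (den L) * wt_form L \<mu> \<nu> \<in> \<int>"
begin

section \<open>Congruence modulo the defining relations\<close>

definition ueq :: "('n, 'c) free_alg \<Rightarrow> ('n, 'c) free_alg \<Rightarrow> bool" (infix "\<doteq>" 50) where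
  "x \<doteq> y \<longleftrightarrow> x - y \<in> uq_ideal L q"

lemma uq_ideal_lmult: "x \<in> uq_ideal L q \<Longrightarrow> z * x \<in> uq_ideal L q"
proof (induction rule: uq_ideal.induct)
  case (gen r x y)
  then show ?case using uq_ideal.gen[of r L q "z * x" y] by (simp add: mult.assoc)
qed (auto simp: distrib_left intro: uq_ideal.intros)

lemma uq_ideal_rmult: "x \<in> uq_ideal L q \<Longrightarrow> x * z \<in> uq_ideal L q"
proof (induction rule: uq_ideal.induct)
  case (gen r x y)
  then show ?case using uq_ideal.gen[of r L q x "y * z"] by (simp add: mult.assoc)
qed (auto simp: distrib_right intro: uq_ideal.intros)

lemma ueq_relator: "x - y \<in> uq_relators L q \<Longrightarrow> x \<doteq> y"
  unfolding ueq_def using uq_ideal.gen[of "x - y" L q 1 1] by simp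

lemma ueq_refl [simp]: "x \<doteq> x"
  by (simp add: ueq_def uq_ideal.zero)

lemma ueq_sym: "x \<doteq> y \<Longrightarrow> y \<doteq> x"
  unfolding ueq_def using uq_ideal_lmult[of "x - y" "-1"] by simp

lemma ueq_trans [trans]: "x \<doteq> y \<Longrightarrow> y \<doteq> z \<Longrightarrow> x \<doteq> z"
  unfolding ueq_def using uq_ideal.add[of "x - y" L q "y - z"] by simp

lemma ueq_lmult: "x \<doteq> y \<Longrightarrow> z * x \<doteq> z * y"
  unfolding ueq_def using uq_ideal_lmult[of "x - y" z] by (simp add: right_diff_distrib)

lemma ueq_rmult: "x \<doteq> y \<Longrightarrow> x * z \<doteq> y * z"
  unfolding ueq_def using uq_ideal_rmult[of "x - y" z] by (simp add: left_diff_distrib)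

lemma gK_mult: "gK \<mu> * gK \<nu> \<doteq> gK (\<mu> + \<nu>)"
  by (intro ueq_relator uq_relators_intros)

lemma gK_zero: "gK 0 \<doteq> 1"
  by (intro ueq_relator uq_relators_intros)

lemma gK_cancel: "gK (- \<mu>) * gK \<mu> \<doteq> 1"
  using ueq_trans[OF gK_mult[of "- \<mu>" \<mu>]] gK_zero by simp

section \<open>Weights and commutation with the Cartan part\<close>

definition wtc :: "'n Plat \<Rightarrow> 'n Qlat \<Rightarrow> 'c" where
  "wtc \<mu> \<gamma> = vpow L q (wt_form L \<mu> (Q_to_P L \<gamma>))"

lemma wtc_nonzero [simp]: "wtc \<mu> \<gamma> \<noteq> 0"
  by (simp add: wtc_def q_nonzero)

lemma wtc_zero [simp]: "wtc \<mu> 0 = 1"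
  by (simp add: wtc_def)

lemma wtc_add: "wtc \<mu> (\<gamma> + \<delta>) = wtc \<mu> \<gamma> * wtc \<mu> \<delta>"
  by (simp add: wtc_def Q_to_P_add wt_form_add_right vpow_add q_nonzero integral)

lemma uq_weight_iff: "uq_weight L q \<gamma> x \<longleftrightarrow> (\<forall>\<mu>. gK \<mu> * x * gK (- \<mu>) \<doteq> cst (wtc \<mu> \<gamma>) * x)"
  by (simp add: uq_weight_def ueq_def wtc_def)

text \<open>Inserting \<open>gK (- \<mu>) * gK \<mu>\<close>, congruent to 1, on the right turns the
  conjugation condition into a rule for moving \<open>gK \<mu>\<close> past
  \<open>x\<close>.\<close>

lemma uq_weight_commute:
  assumes "uq_weight L q \<gamma> x"
  shows "gK \<mu> * x \<doteq> cst (wtc \<mu> \<gamma>) * (x * gK \<mu>)"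
proof -
  have "gK \<mu> * x \<doteq> gK \<mu> * x * gK (- \<mu>) * gK \<mu>"
    using ueq_lmult[OF ueq_sym[OF gK_cancel], of "gK \<mu> * x" \<mu>] by (simp add: mult.assoc)
  also have "\<dots> \<doteq> cst (wtc \<mu> \<gamma>) * x * gK \<mu>"
    using assms by (intro ueq_rmult) (simp add: uq_weight_iff)
  finally show ?thesis by (simp add: mult.assoc)
qed

lemma uq_weightI:
  assumes "\<And>\<mu>. gK \<mu> * x \<doteq> cst (wtc \<mu> \<gamma>) * (x * gK \<mu>)"
  shows "uq_weight L q \<gamma> x"
  unfolding uq_weight_iff
proof
  fix \<mu> :: "'n Plat"
  have "gK \<mu> * x * gK (- \<mu>) \<doteq> cst (wtc \<mu> \<gamma>) * (x * gK \<mu>) * gK (- \<mu>)"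
    by (intro ueq_rmult assms)
  also have "\<dots> \<doteq> cst (wtc \<mu> \<gamma>) * x * 1"
    using ueq_lmult[OF gK_cancel[of "- \<mu>"], of "cst (wtc \<mu> \<gamma>) * x"] by (simp add: mult.assoc)
  finally show "gK \<mu> * x * gK (- \<mu>) \<doteq> cst (wtc \<mu> \<gamma>) * x" by simp
qed

lemma uq_weight_commute_right:
  assumes "uq_weight L q \<gamma> x"
  shows "x * gK \<mu> \<doteq> cst (inverse (wtc \<mu> \<gamma>)) * (gK \<mu> * x)"
proof -
  have "cst (inverse (wtc \<mu> \<gamma>)) * (gK \<mu> * x) \<doteq> cst (inverse (wtc \<mu> \<gamma>)) * (cst (wtc \<mu> \<gamma>) * (x * gK \<mu>))"
    by (intro ueq_lmult uq_weight_commute assms)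
  also have "\<dots> = x * gK \<mu>"
    by (simp flip: mult.assoc cst_mult)
  finally show ?thesis by (rule ueq_sym)
qed

lemma uq_weight_one: "uq_weight L q 0 1"
  by (rule uq_weightI) simp

lemma uq_weight_mult:
  assumes "uq_weight L q \<gamma> x" "uq_weight L q \<delta> y"
  shows "uq_weight L q (\<gamma> + \<delta>) (x * y)"
proof (rule uq_weightI)
  fix \<mu> :: "'n Plat"
  have "gK \<mu> * (x * y) \<doteq> cst (wtc \<mu> \<gamma>) * x * (gK \<mu> * y)"
    using ueq_rmult[OF uq_weight_commute[OF assms(1)], of \<mu> y] by (simp add: mult.assoc)
  also have "\<dots> \<doteq> cst (wtc \<mu> \<gamma>) * x * (cst (wtc \<mu> \<delta>) * (y * gK \<mu>))"
    by (intro ueq_lmult uq_weight_commute assms)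
  also have "\<dots> = cst (wtc \<mu> (\<gamma> + \<delta>)) * (x * y * gK \<mu>)"
    by (simp add: wtc_add cst_mult cst_left_commute[of x] mult.assoc)
  finally show "gK \<mu> * (x * y) \<doteq> \<dots>" .
qed

lemma uq_weight_gE: "uq_weight L q (sroot i) (gE i)"
  unfolding uq_weight_iff wtc_def by (intro allI ueq_relator uq_relators_intros)

lemma uq_weight_gF: "uq_weight L q (- sroot i) (gF i)"
  unfolding uq_weight_iff wtc_def Q_to_P_uminus wt_form_uminus_right
  by (intro allI ueq_relator uq_relators_intros)

lemma uq_weight_gK: "uq_weight L q 0 (gK \<nu>)"
proof (rule uq_weightI)
  fix \<mu> :: "'n Plat"
  have "gK \<mu> * gK \<nu> \<doteq> gK (\<nu> + \<mu>)"
    using gK_mult[of \<mu> \<nu>] by (simp add: add.commute)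
  also have "\<dots> \<doteq> gK \<nu> * gK \<mu>" by (rule ueq_sym[OF gK_mult])
  finally show "gK \<mu> * gK \<nu> \<doteq> cst (wtc \<mu> 0) * (gK \<nu> * gK \<mu>)" by simp
qed

lemma uq_weight_sev_e: "uq_weight L q (sroot i) (sev_e n i)"
  using uq_weight_mult[OF uq_weight_gE uq_weight_gK] by (simp add: sev_e_def)

lemma uq_weight_sev_f: "uq_weight L q (- sroot i) (sev_f n i)"
  using uq_weight_mult[OF uq_weight_gK uq_weight_gF] by (simp add: sev_f_def)

text \<open>Supplies the weight \<open>- \<beta>\<close> that the defining formula of the reduction
  map asks for.\<close>

lemma uq_weight_sev_f_word:
  "uq_weight L q (- sum_list (map sroot js)) (prod_list (map (sev_f n) js))"
proof (induction js)
  case (Cons j js)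
  then show ?case
    using uq_weight_mult[OF uq_weight_sev_f[of j n] Cons] by simp
qed (simp add: uq_weight_one)

section \<open>Normal ordering of words in the generators\<close>

lemma gE_gF_commutator:
  obtains t where "gE i * gF j \<doteq> gF j * gE i + t"
    and "t = 0 \<or> (\<exists>c. t = cst c * gK (Q_to_P L (sroot i)) + cst (- c) * gK (- Q_to_P L (sroot i)))"
proof
  define c where "c = 1 / (vpow L q (of_int (symd L i)) - inverse (vpow L q (of_int (symd L i))))"
  define t where
    "t = (if i = j then cst c * (gK (Q_to_P L (sroot i)) - gK (- Q_to_P L (sroot i))) else 0)"
  have "gE i * gF j - gF j * gE i - t \<in> uq_relators L q"
    unfolding t_def c_def by (rule uq_relators_intros)
  then show "gE i * gF j \<doteq> gF j * gE i + t"
    by (intro ueq_relator) (simp only: diff_diff_eq)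
  have "cst c * (x - y) = cst c * x + cst (- c) * y" for x y :: "('n, 'c) free_alg"
    by (simp add: cst_def single_uminus right_diff_distrib)
  then show "t = 0 \<or> (\<exists>c. t = cst c * gK (Q_to_P L (sroot i)) + cst (- c) * gK (- Q_to_P L (sroot i)))"
    unfolding t_def by (cases "i = j") auto
qed

text \<open>The span of the products f K e of twisted generators, closed under congruence. Being
  inductive, it lets a linear property that respects congruence be checked on these products alone,
  without choosing an expansion.\<close>

inductive_set tri :: "('n \<Rightarrow> 'n \<Rightarrow> int) \<Rightarrow> ('n \<Rightarrow> 'n \<Rightarrow> int) \<Rightarrow> ('n, 'c) free_alg set" for nm np where
  base: "prod_list (map (sev_f nm) js) * gK \<mu> * prod_list (map (sev_e np) is) \<in> tri nm np"
| scale: "x \<in> tri nm np \<Longrightarrow> cst c * x \<in> tri nm np"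
| add: "x \<in> tri nm np \<Longrightarrow> y \<in> tri nm np \<Longrightarrow> x + y \<in> tri nm np"
| ueq: "x \<in> tri nm np \<Longrightarrow> y \<doteq> x \<Longrightarrow> y \<in> tri nm np"

lemma zero_in_tri: "0 \<in> tri nm np"
  using tri.scale[OF tri.base[of nm "[]" 0 np "[]"], of 0] by simp

text \<open>Left multiplication is linear and respects congruence, so closure under it is decided on
  the spanning products.\<close>

lemma tri_lmult:
  assumes "x \<in> tri nm np"
    and "\<And>js \<mu> is. g * (prod_list (map (sev_f nm) js) * gK \<mu> * prod_list (map (sev_e np) is)) \<in> tri nm np"
  shows "g * x \<in> tri nm np"
  using assms(1)
proof (induction rule: tri.induct)
  case (base js \<mu> "is")
  then show ?case using assms(2) .
next
  case (scale x c)
  then show ?case by (simp add: cst_left_commute[of g] tri.scale)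
next
  case (add x y)
  then show ?case by (simp add: distrib_left tri.add)
next
  case (ueq x y)
  then show ?case using tri.ueq ueq_lmult by blast
qed

lemma sev_f_tri: "x \<in> tri nm np \<Longrightarrow> sev_f nm j * x \<in> tri nm np"
proof (erule tri_lmult)
  show "sev_f nm j * (prod_list (map (sev_f nm) js) * gK \<mu> * prod_list (map (sev_e np) is)) \<in> tri nm np"
    for js \<mu> "is"
    using tri.base[of nm "j # js" \<mu> np "is"] by (simp add: mult.assoc)
qed

text \<open>\<open>gK \<nu>\<close> passes the f-word at the cost of a scalar and merges with
  \<open>gK \<mu>\<close>.\<close>

lemma gK_tri: "x \<in> tri nm np \<Longrightarrow> gK \<nu> * x \<in> tri nm np"
proof (erule tri_lmult)
  fix js \<mu> "is"
  let ?f = "prod_list (map (sev_f nm) js)" and ?e = "prod_list (map (sev_e np) is)"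
  define s where "s = wtc \<nu> (- sum_list (map sroot js))"
  have "gK \<nu> * (?f * gK \<mu> * ?e) = gK \<nu> * ?f * (gK \<mu> * ?e)"
    by (simp add: mult.assoc)
  also have "\<dots> \<doteq> cst s * (?f * gK \<nu>) * (gK \<mu> * ?e)"
    unfolding s_def by (intro ueq_rmult uq_weight_commute uq_weight_sev_f_word)
  also have "\<dots> = cst s * ?f * (gK \<nu> * gK \<mu> * ?e)"
    by (simp add: mult.assoc)
  also have "\<dots> \<doteq> cst s * ?f * (gK (\<nu> + \<mu>) * ?e)"
    by (intro ueq_lmult ueq_rmult gK_mult)
  also have "\<dots> = cst s * (?f * gK (\<nu> + \<mu>) * ?e)"
    by (simp add: mult.assoc)
  finally show "gK \<nu> * (?f * gK \<mu> * ?e) \<in> tri nm np"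
    by (rule tri.ueq[rotated]) (intro tri.scale tri.base)
qed

text \<open>Up to congruence \<open>gF j\<close> is \<open>gK (sev_nu nm j)\<close> times the
  twisted generator, so the two previous closures combine.\<close>

lemma gF_tri:
  assumes "x \<in> tri nm np"
  shows "gF j * x \<in> tri nm np"
proof -
  have "gF j * x \<doteq> (gK (- (- sev_nu nm j)) * gK (- sev_nu nm j)) * (gF j * x)"
    using ueq_rmult[OF ueq_sym[OF gK_cancel], of "gF j * x" "- sev_nu nm j"] by simp
  also have "\<dots> = gK (sev_nu nm j) * (sev_f nm j * x)"
    by (simp add: sev_f_def mult.assoc)
  finally show ?thesis
    by (rule tri.ueq[rotated]) (intro gK_tri sev_f_tri assms)
qed

text \<open>Induction on the f-word: moving \<open>gE i\<close> past its first letter produces a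
  scalar, \<open>gE i\<close> in front of a shorter word, and a Cartan correction.\<close>

lemma gE_tri: "x \<in> tri nm np \<Longrightarrow> gE i * x \<in> tri nm np"
proof (erule tri_lmult)
  show "gE i * (prod_list (map (sev_f nm) js) * gK \<mu> * prod_list (map (sev_e np) is)) \<in> tri nm np"
    for js \<mu> "is"
  proof (induction js)
    case Nil
    let ?e = "prod_list (map (sev_e np) is)" and ?\<nu> = "sev_nu np i"
    \<comment> \<open>The factor \<open>gK ?\<nu>\<close> is split off to complete
      \<open>gE i\<close> to \<open>sev_e np i\<close>, which then moves right to join the
      e-word.\<close>
    have "gK \<mu> \<doteq> gK ?\<nu> * gK (\<mu> - ?\<nu>)"
      using ueq_sym[OF gK_mult[of ?\<nu> "\<mu> - ?\<nu>"]] by simp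
    then have "gE i * gK \<mu> \<doteq> gE i * (gK ?\<nu> * gK (\<mu> - ?\<nu>))"
      by (rule ueq_lmult)
    also have "\<dots> = sev_e np i * gK (\<mu> - ?\<nu>)"
      by (simp add: sev_e_def mult.assoc)
    also have "\<dots> \<doteq> cst (inverse (wtc (\<mu> - ?\<nu>) (sroot i))) * (gK (\<mu> - ?\<nu>) * sev_e np i)"
      (is "_ \<doteq> cst ?s * _")
      by (rule uq_weight_commute_right[OF uq_weight_sev_e])
    finally have "gE i * (gK \<mu> * ?e) \<doteq> cst ?s * (gK (\<mu> - ?\<nu>) * (sev_e np i * ?e))"
      by (drule_tac ueq_rmult[where z = ?e]) (simp only: mult.assoc)
    then show ?case
      using tri.ueq[OF tri.scale[OF tri.base[of nm "[]" "\<mu> - ?\<nu>" np "i # is"]]]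
      by (simp add: mult.assoc)
  next
    case (Cons j js)
    define y :: "('n, 'c) free_alg" where "y = prod_list (map (sev_f nm) js) * gK \<mu> * prod_list (map (sev_e np) is)"
    have y: "y \<in> tri nm np" unfolding y_def by (rule tri.base)
    have Ey: "gE i * y \<in> tri nm np" unfolding y_def by (rule Cons)
    let ?K = "gK (- sev_nu nm j)" and ?s = "inverse (wtc (- sev_nu nm j) (sroot i))"
    obtain t where t: "gE i * gF j \<doteq> gF j * gE i + t" "t = 0 \<or>
        (\<exists>c. t = cst c * gK (Q_to_P L (sroot i)) + cst (- c) * gK (- Q_to_P L (sroot i)))"
      by (rule gE_gF_commutator)
    \<comment> \<open>The commutator term is zero or a combination of two Cartan elements, so
      closure under \<open>gK\<close> handles it.\<close>
    have ty: "t * y \<in> tri nm np"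
      using t(2) by (auto simp: distrib_right mult.assoc zero_in_tri intro!: tri.add tri.scale gK_tri y)
    have "gE i * (sev_f nm j * y) = gE i * ?K * (gF j * y)"
      by (simp add: sev_f_def mult.assoc)
    also have "\<dots> \<doteq> cst ?s * (?K * gE i) * (gF j * y)"
      by (intro ueq_rmult uq_weight_commute_right uq_weight_gE)
    also have "\<dots> = cst ?s * ?K * (gE i * gF j * y)"
      by (simp add: mult.assoc)
    also have "\<dots> \<doteq> cst ?s * ?K * ((gF j * gE i + t) * y)"
      by (intro ueq_lmult ueq_rmult t(1))
    also have "\<dots> = cst ?s * (sev_f nm j * (gE i * y) + ?K * (t * y))"
      by (simp add: sev_f_def distrib_left distrib_right mult.assoc)
    finally have "gE i * (sev_f nm j * y) \<in> tri nm np"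
      by (rule tri.ueq[rotated]) (intro tri.scale tri.add sev_f_tri gK_tri Ey ty)
    then show ?case by (simp add: y_def mult.assoc)
  qed
qed

text \<open>\<open>tri\<close> contains 1 and is stable under left multiplication by every
  generator, so it contains all words and their combinations.\<close>

lemma triangular_spanning: "x \<in> tri nm np"
proof (induction x rule: poly_mapping_additive_induct)
  case zero
  then show ?case by (rule zero_in_tri)
next
  case (single w c)
  have one: "1 \<in> tri nm np"
    using tri.ueq[OF tri.base[of nm "[]" 0 np "[]"] ueq_sym] gK_zero by simp
  have "Poly_Mapping.single (GW gs) 1 \<in> tri nm np" for gs
  proof (induction gs)
    case Nil
    then show ?case using one by (simp flip: zero_gword_def)
  next
    case (Cons g gs)
    have "(Poly_Mapping.single (GW (g # gs)) 1 :: ('n, 'c) free_alg)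
        = Poly_Mapping.single (GW [g]) 1 * Poly_Mapping.single (GW gs) 1"
      by (simp add: mult_single)
    then show ?case
      using gE_tri[OF Cons] gF_tri[OF Cons] gK_tri[OF Cons]
      by (cases g) (simp_all add: gE_def gF_def gK_def)
  qed
  then have "cst c * Poly_Mapping.single w 1 \<in> tri nm np"
    by (cases w) (simp add: tri.scale)
  then show ?case by (simp add: cst_mult_single)
next
  case (add x y)
  then show ?case by (rule tri.add)
qed

end


section \<open>Extension of scalars\<close>

lemma lookup_extend_scalars: "Poly_Mapping.lookup (extend_scalars x) w = \<iota> (Poly_Mapping.lookup x w)"
  by (simp add: extend_scalars_def lookup_map_eq)

lemma extend_scalars_add: "extend_scalars (x + y) = extend_scalars x + extend_scalars y"
  by (rule poly_mapping_eqI) (simp add: lookup_extend_scalars lookup_add \<iota>_add)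

lemma extend_scalars_diff: "extend_scalars (x - y) = extend_scalars x - extend_scalars y"
  by (rule poly_mapping_eqI) (simp add: lookup_extend_scalars lookup_minus \<iota>_diff)

lemma extend_scalars_single: "extend_scalars (Poly_Mapping.single w c) = Poly_Mapping.single w (\<iota> c)"
  by (rule poly_mapping_eqI) (simp add: lookup_extend_scalars lookup_single when_def)

lemma extend_scalars_zero [simp]: "extend_scalars 0 = 0"
  by (rule poly_mapping_eqI) (simp add: lookup_extend_scalars)

lemma extend_scalars_one [simp]: "extend_scalars 1 = 1"
  unfolding single_one[symmetric] by (simp only: extend_scalars_single \<iota>_one)

lemma extend_scalars_mult: "extend_scalars (x * y) = extend_scalars x * extend_scalars y"
proof (induction x rule: poly_mapping_additive_induct)
  case (single w c)
  show ?case
    by (induction y rule: poly_mapping_additive_induct)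
      (simp_all add: mult_single extend_scalars_single \<iota>_mult distrib_left extend_scalars_add)
qed (simp_all add: distrib_right extend_scalars_add)

lemma extend_scalars_power: "extend_scalars (x ^ n) = extend_scalars x ^ n"
  by (induction n) (simp_all add: extend_scalars_mult)

lemma extend_scalars_prod_list:
  "extend_scalars (prod_list (map f xs)) = prod_list (map (\<lambda>x. extend_scalars (f x)) xs)"
  by (induction xs) (simp_all add: extend_scalars_mult)

lemma extend_scalars_sum: "extend_scalars (\<Sum>x\<in>A. f x) = (\<Sum>x\<in>A. extend_scalars (f x))"
  by (induction A rule: infinite_finite_induct) (simp_all add: extend_scalars_add)

lemma extend_scalars_cst: "extend_scalars (cst c) = cst (\<iota> c)"
  by (simp add: cst_def extend_scalars_single)

lemma extend_scalars_gen [simp]: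
  "extend_scalars (gE i) = gE i" "extend_scalars (gF i) = gF i" "extend_scalars (gK \<mu>) = gK \<mu>"
  by (simp_all add: gE_def gF_def gK_def extend_scalars_single)

lemma extend_scalars_sev [simp]:
  "extend_scalars (sev_e n i) = sev_e n i" "extend_scalars (sev_f n i) = sev_f n i"
  by (simp_all add: sev_e_def sev_f_def extend_scalars_mult)

lemma extend_scalars_serre:
  fixes X :: "'n::{finite,linorder} \<Rightarrow> ('n, Cq) free_alg"
  assumes "\<And>i. extend_scalars (X i) = X' i"
  shows "extend_scalars (serre L q X i j) = serre L (\<iota> q) X' i j"
proof -
  have "\<iota> ((- 1) ^ r) = ((- 1) ^ r :: 'n kfield)" for r
    by (simp add: \<iota>_power \<iota>_uminus)
  then show ?thesis
    by (simp add: serre_def Let_def extend_scalars_sum extend_scalars_mult extend_scalars_power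
        extend_scalars_cst \<iota>_mult \<iota>_qbinom \<iota>_vpow assms)
qed

text \<open>The coefficients of the relators are the same rational expressions in \<open>q\<close>
  over both fields, and \<iota> is a field homomorphism.\<close>

lemma extend_scalars_relator:
  assumes "r \<in> uq_relators L q"
  shows "extend_scalars r \<in> uq_relators L (\<iota> q)"
proof -
  \<comment> \<open>Keeps the case distinction in the commutator relator intact, so that the result
    still matches its membership rule.\<close>
  have ext_if: "extend_scalars (if P then x else 0) = (if P then extend_scalars x else 0)" for P x
    by simp
  note ext = extend_scalars_diff extend_scalars_mult extend_scalars_cst extend_scalars_gen
    extend_scalars_one ext_if \<iota>_vpow \<iota>_divide \<iota>_diff \<iota>_inverse \<iota>_one
  from assms[unfolded uq_relators_def] show ?thesis
    by (elim UnE CollectE exE conjE singletonE)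
      (simp_all only: ext extend_scalars_serre[where X' = gE] extend_scalars_serre[where X' = gF]
        uq_relators_intros not_False_eq_True)
qed

lemma extend_scalars_ideal: "x \<in> uq_ideal L q \<Longrightarrow> extend_scalars x \<in> uq_ideal L (\<iota> q)"
  by (induction rule: uq_ideal.induct)
    (auto simp: extend_scalars_add extend_scalars_mult intro: uq_ideal.intros extend_scalars_relator)

text \<open>Relators act by zero and each operator is additive, so the products generating the ideal
  act by zero too. Hence the action depends only on the class in the quantum group.\<close>

lemma uq_module_ideal:
  assumes "uq_module L q sc \<pi>" "x \<in> uq_ideal L q"
  shows "\<pi> x w = 0"
  using assms(2)
proof (induction arbitrary: w rule: uq_ideal.induct)
  case zero
  have "\<pi> (0 + 0) w = \<pi> 0 w + \<pi> 0 w"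
    using assms(1) unfolding uq_module_def by blast
  then show ?case by simp
next
  case (gen r x y)
  have "Vector_Spaces.linear sc sc (\<pi> x)"
    using assms(1) unfolding uq_module_def by blast
  then have "\<pi> x 0 = 0"
    by (rule module_hom.zero[OF Vector_Spaces.linear.axioms(3)])
  moreover have "\<pi> (x * r * y) w = \<pi> x (\<pi> r (\<pi> y w))" "\<pi> r (\<pi> y w) = 0"
    using assms(1) gen unfolding uq_module_def by metis+
  ultimately show ?case by simp
next
  case (add x y)
  have "\<pi> (x + y) w = \<pi> x w + \<pi> y w"
    using assms(1) unfolding uq_module_def by blast
  then show ?case by (simp add: add.IH)
qed


section \<open>Formal series and difference operators\<close>

text \<open>For a fixed series and exponent the action is linear in the operator; this form makes
  sums and multiples of operators accessible.\<close>

lemma act_D_eq_lin_eval: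
  "act_D L q u D \<phi> \<kappa> =
     lin_eval (\<lambda>(\<alpha>, \<mu>). vlam u \<mu> * vpow L q (- wt_form L \<mu> (\<kappa> + Q_to_P L \<alpha>)) * \<phi> (\<kappa> + Q_to_P L \<alpha>)) D"
  by (simp add: act_D_def lin_eval_def act_e_def act_T_def case_prod_unfold)

text \<open>Conjugation by the exponential of \<rho> translates exponents by \<rho>: the factor it
  attaches to T is exactly the change of the eigenvalue of T under this translation.\<close>

lemma act_D_rho_conj:
  fixes L :: "'n::finite lie_data"
  assumes "q \<noteq> 0" and integral: "\<And>\<mu> \<nu>. of_nat (den L) * wt_form L \<mu> \<nu> \<in> \<int>"
  shows "act_D L q u (rho_conj L q D) \<phi> \<kappa> = act_D L q u D (\<lambda>\<kappa>. \<phi> (\<kappa> - \<rho>)) (\<kappa> + \<rho>)"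
proof -
  have vp: "vpow L q (- wt_form L \<mu> (\<nu> + \<rho>)) = vpow L q (- wt_form L \<mu> \<nu>) * vpow L q (- wt_form L \<mu> \<rho>)"
    for \<mu> \<nu> :: "'n Plat"
    using vpow_add[OF assms(1), of L "wt_form L \<mu> (- \<nu>)" "wt_form L \<mu> (- \<rho>)"]
    by (simp add: integral wt_form_add_right wt_form_uminus_right)
  have "act_D L q u (rho_conj L q D) \<phi> \<kappa> = (\<Sum>(\<alpha>, \<mu>)\<in>Poly_Mapping.keys D.
      vpow L q (- wt_form L \<mu> \<rho>) * Poly_Mapping.lookup D (\<alpha>, \<mu>)
      * (vlam u \<mu> * vpow L q (- wt_form L \<mu> (\<kappa> + Q_to_P L \<alpha>)) * \<phi> (\<kappa> + Q_to_P L \<alpha>)))"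
    by (simp add: act_D_eq_lin_eval rho_conj_def lin_eval_sum case_prod_unfold)
  also have "\<dots> = (\<Sum>(\<alpha>, \<mu>)\<in>Poly_Mapping.keys D. Poly_Mapping.lookup D (\<alpha>, \<mu>)
      * (vlam u \<mu> * vpow L q (- wt_form L \<mu> (\<kappa> + Q_to_P L \<alpha> + \<rho>)) * \<phi> (\<kappa> + Q_to_P L \<alpha>)))"
    by (simp only: vp mult_ac)
  also have "\<dots> = act_D L q u D (\<lambda>\<kappa>. \<phi> (\<kappa> - \<rho>)) (\<kappa> + \<rho>)"
    by (simp add: act_D_eq_lin_eval lin_eval_def case_prod_unfold add_ac)
  finally show ?thesis .
qed

lemma gen_series_shift: "gen_series L s J \<kappa> = gen_series L 0 J (\<kappa> + s)"
proof -
  have "Q_to_P L \<beta> - s = \<kappa> \<longleftrightarrow> Q_to_P L \<beta> - 0 = \<kappa> + s" for \<beta>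
    by (auto simp: algebra_simps)
  then show ?thesis by (simp only: gen_series_def)
qed

lemma gen_series_not_in_range: "\<kappa> \<notin> range (Q_to_P L) \<Longrightarrow> gen_series L 0 J \<kappa> = 0"
  unfolding gen_series_def by (rule sum.neutral) auto

text \<open>Injectivity of \<open>Q_to_P\<close> leaves at most one index in the sum; vanishing of
  \<open>J\<close> off \<open>Q_plus\<close> covers the empty case.\<close>

lemma gen_series_Q_to_P:
  assumes "semisimple_data L" "\<And>\<beta>. \<beta> \<notin> Q_plus \<Longrightarrow> J \<beta> = 0"
  shows "gen_series L 0 J (Q_to_P L \<beta>) = J \<beta>"
proof -
  have "{\<gamma> \<in> Q_plus. Q_to_P L \<gamma> - 0 = Q_to_P L \<beta>} = (if \<beta> \<in> Q_plus then {\<beta>} else {})"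
    using injD[OF inj_Q_to_P[OF assms(1)]] by auto
  then show ?thesis by (simp add: gen_series_def assms(2))
qed


section \<open>Whittaker vectors\<close>

locale whittaker_pair =
  fixes L :: "'n::{finite,linorder} lie_data"
    and sc :: "'n kfield \<Rightarrow> 'w::ab_group_add \<Rightarrow> 'w"
    and \<pi> :: "('n, 'n kfield) free_alg \<Rightarrow> 'w \<Rightarrow> 'w"
    and one :: 'w
    and scb :: "'n kfield \<Rightarrow> 'z::ab_group_add \<Rightarrow> 'z"
    and \<pi>b :: "('n, 'n kfield) free_alg \<Rightarrow> 'z \<Rightarrow> 'z"
    and oneb :: 'z
    and B :: "'w \<Rightarrow> 'z \<Rightarrow> 'n kfield"
    and np nm :: "'n \<Rightarrow> 'n \<Rightarrow> int"
    and cp cm :: "'n \<Rightarrow> 'n kfield"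
    and \<theta> :: "'n Qlat \<Rightarrow> 'w"
    and \<theta>b :: "'n Qlat \<Rightarrow> 'z"
  assumes semisimple: "semisimple_data L"
    and verma_module: "uq_module L (\<iota> vroot) sc \<pi>"
    and pairing: "verma_pairing sc \<pi> one scb \<pi>b oneb B"
    and whittaker: "whittaker_vector L (\<iota> vroot) uvar sc \<pi> one np cp \<theta>"
    and whittaker_bar:
      "whittaker_vector L (inverse (\<iota> vroot)) (\<lambda>i. inverse (uvar i)) scb \<pi>b oneb nm cm \<theta>b"
begin

lemma integral: "of_nat (den L) * wt_form L \<mu> \<nu> \<in> \<int>"
  using semisimple unfolding semisimple_data_def by blast

sublocale quantum_group L vroot
  by unfold_locales (simp_all add: integral)

section \<open>Linearity of the action and of the pairing\<close>

lemma \<pi>_add: "\<pi> (x + y) w = \<pi> x w + \<pi> y w"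
  using verma_module unfolding uq_module_def by blast

lemma \<pi>_mult: "\<pi> (x * y) w = \<pi> x (\<pi> y w)"
  using verma_module unfolding uq_module_def by blast

lemma \<pi>_cst: "\<pi> (cst c) w = sc c w"
  using verma_module unfolding uq_module_def by blast

lemma \<pi>_sc: "\<pi> x (sc c w) = sc c (\<pi> x w)"
proof -
  have "Vector_Spaces.linear sc sc (\<pi> x)"
    using verma_module unfolding uq_module_def by blast
  then show ?thesis by (rule module_hom.scale[OF Vector_Spaces.linear.axioms(3)])
qed

lemma sc_sc: "sc a (sc b w) = sc (a * b) w"
  by (metis \<pi>_cst \<pi>_mult cst_mult)

lemma sc_one: "sc 1 w = w"
proof -
  have "vector_space sc"
    using verma_module unfolding uq_module_def by blast
  then show ?thesis by (simp add: vector_space_def)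
qed

lemma B_linear_left: "Vector_Spaces.linear sc (*) (\<lambda>w. B w z)"
  using pairing unfolding verma_pairing_def by (elim conjE) (rule spec)

lemma B_linear_right: "Vector_Spaces.linear scb (*) (B w)"
  using pairing unfolding verma_pairing_def by (elim conjE) (rule spec)

lemma B_add: "B (w + w') z = B w z + B w' z"
  by (rule module_hom.add[OF Vector_Spaces.linear.axioms(3)[OF B_linear_left]])

lemma B_sc: "B (sc c w) z = c * B w z"
  by (rule module_hom.scale[OF Vector_Spaces.linear.axioms(3)[OF B_linear_left]])

lemma B_zero: "B 0 z = 0"
  by (rule module_hom.zero[OF Vector_Spaces.linear.axioms(3)[OF B_linear_left]])

lemma B_scb: "B w (scb c z) = c * B w z"
  by (rule module_hom.scale[OF Vector_Spaces.linear.axioms(3)[OF B_linear_right]])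

lemma B_\<sigma>: "B (\<pi> x w) z = B w (\<pi>b (\<sigma> x) z)"
  using pairing unfolding verma_pairing_def by (elim conjE) (simp only:)

lemma gK_\<theta>: "\<pi> (gK \<mu>) (\<theta> \<beta>) = sc (vlam uvar \<mu> * vpow L (\<iota> vroot) (- wt_form L \<mu> (Q_to_P L \<beta>))) (\<theta> \<beta>)"
  using whittaker unfolding whittaker_vector_def verma_wt_space_def by blast

text \<open>The map \<sigma> inverts Cartan elements, and the barred module inverts both
  \<open>v\<close> and the \<open>uvar i\<close>. The two inversions cancel, giving the eigenvalue
  formula of \<open>gK_\<theta>\<close>.\<close>

lemma gK_\<theta>b:
  "\<pi>b (gK (- \<mu>)) (\<theta>b \<beta>) = scb (vlam uvar \<mu> * vpow L (\<iota> vroot) (- wt_form L \<mu> (Q_to_P L \<beta>))) (\<theta>b \<beta>)"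
proof -
  have "\<pi>b (gK (- \<mu>)) (\<theta>b \<beta>) = scb (vlam (\<lambda>i. inverse (uvar i)) (- \<mu>)
      * vpow L (inverse (\<iota> vroot)) (- wt_form L (- \<mu>) (Q_to_P L \<beta>))) (\<theta>b \<beta>)"
    using whittaker_bar unfolding whittaker_vector_def verma_wt_space_def by blast
  then show ?thesis
    by (simp add: vlam_inverse wt_form_uminus_left vpow_inverse integral)
qed

lemma \<sigma>_single: "\<sigma> (Poly_Mapping.single w (1 :: 'n kfield)) = Poly_Mapping.single (sigma_word w) 1"
  by (simp add: \<sigma>_def)

text \<open>Compares the eigenvalues of \<open>K\<^sub>\<omega>\<^sub>i\<close>: \<open>(\<omega>\<^sub>i, \<beta>) = d\<^sub>i \<beta>\<^sub>i\<close> and \<open>v\<close> is not a root of unity.\<close>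

lemma B_orthogonal:
  assumes "\<beta> \<noteq> \<gamma>"
  shows "B (\<theta> \<beta>) (\<theta>b \<gamma>) = 0"
proof (rule ccontr)
  assume nz: "B (\<theta> \<beta>) (\<theta>b \<gamma>) \<noteq> 0"
  have "\<beta> $ i = \<gamma> $ i" for i
  proof -
    \<comment> \<open>N times the pairing of \<delta> with the i-th fundamental weight: minus the
      exponent of the N-th root of \<open>v\<close> in the eigenvalue.\<close>
    define m where "m \<delta> = int (den L) * (symd L i * \<delta> $ i)" for \<delta> :: "'n Qlat"
    have vp: "vpow L (\<iota> vroot) (- wt_form L (fweight i) (Q_to_P L \<delta>)) = (\<iota> vroot :: 'n kfield) powi (- m \<delta>)" for \<delta>
    proof -
      have "of_nat (den L) * - wt_form L (fweight i) (Q_to_P L \<delta>) = of_int (- m \<delta>)"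
        by (simp add: wt_form_fweight_Q_to_P[OF semisimple] m_def)
      then show ?thesis by (simp only: vpow_def floor_of_int)
    qed
    have "\<sigma> (gK (fweight i)) = (gK (- fweight i) :: ('n, 'n kfield) free_alg)"
      by (simp add: gK_def \<sigma>_single)
    then have "B (\<pi> (gK (fweight i)) (\<theta> \<beta>)) (\<theta>b \<gamma>) = B (\<theta> \<beta>) (\<pi>b (gK (- fweight i)) (\<theta>b \<gamma>))"
      by (simp add: B_\<sigma>)
    \<comment> \<open>The nonzero pairing and the common factor \<open>vlam uvar (fweight i)\<close>
      cancel.\<close>
    then have "(\<iota> vroot :: 'n kfield) powi (- m \<beta>) = \<iota> vroot powi (- m \<gamma>)"
      using nz vlam_nonzero[of uvar "fweight i"] by (simp add: gK_\<theta> gK_\<theta>b B_sc B_scb vp)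
    then have "(\<iota> vroot :: 'n kfield) powi (- m \<beta>) * \<iota> vroot powi m \<gamma> = 1"
      by (simp flip: power_int_add)
    then have "(\<iota> vroot :: 'n kfield) powi (m \<gamma> - m \<beta>) = 1"
      by (simp flip: power_int_add)
    then have "m \<gamma> = m \<beta>"
      by (simp add: \<iota>_vroot_not_root_of_unity)
    moreover have "0 < den L" "0 < symd L i"
      using semisimple unfolding semisimple_data_def by blast+
    ultimately show ?thesis by (simp add: m_def)
  qed
  then show False using assms by (simp add: vec_eq_iff)
qed

text \<open>The Whittaker equation iterated, one simple root per letter. It holds at every index of
  the root lattice, \<theta> being extended by zero, so \<beta> is unrestricted.\<close>

lemma sev_e_word_\<theta>:
  "\<pi> (prod_list (map (sev_e np) is)) (\<theta> \<beta>)
    = sc (prod_list (map cp is)) (\<theta> (\<beta> - sum_list (map sroot is)))"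
proof (induction "is")
  case Nil
  show ?case using \<pi>_cst[of 1] by simp
next
  case (Cons i "is")
  have "\<pi> (sev_e np i) (\<theta> (\<gamma> + sroot i)) = sc (cp i) (\<theta> \<gamma>)" for \<gamma>
    using whittaker unfolding whittaker_vector_def sev_e_def by blast
  from this[of "\<beta> - sum_list (map sroot (i # is))"] show ?case
    by (simp add: \<pi>_mult Cons \<pi>_sc sc_sc mult.commute algebra_simps)
qed

text \<open>The adjoint of \<open>sev_f nm j\<close> under the pairing is
  \<open>gE j * gK (sev_nu nm j)\<close>, the operator in the barred Whittaker equation. Letters
  cross one at a time from the left, each lowering the index of \<open>\<theta>b\<close>, hence the
  induction over all \<beta>.\<close>

lemma B_sev_f_word:
  "B (\<pi> (prod_list (map (sev_f nm) js)) w) (\<theta>b \<beta>)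
    = prod_list (map cm js) * B w (\<theta>b (\<beta> - sum_list (map sroot js)))"
proof (induction js arbitrary: \<beta>)
  case Nil
  show ?case using \<pi>_cst[of 1 w] by (simp add: sc_one)
next
  case (Cons j js)
  have "\<sigma> (sev_f nm j) = (gE j * gK (sev_nu nm j) :: ('n, 'n kfield) free_alg)"
    by (simp add: sev_f_def gK_def gF_def gE_def mult_single \<sigma>_single)
  moreover have "\<pi>b (gE j * gK (sev_nu nm j)) (\<theta>b (\<gamma> + sroot j)) = scb (cm j) (\<theta>b \<gamma>)" for \<gamma>
    using whittaker_bar unfolding whittaker_vector_def by blast
  from this[of "\<beta> - sroot j"] calculation
  have "\<pi>b (\<sigma> (sev_f nm j)) (\<theta>b \<beta>) = scb (cm j) (\<theta>b (\<beta> - sroot j))"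
    by simp
  then show ?case
    by (simp add: \<pi>_mult B_\<sigma>[of "sev_f nm j"] B_scb Cons mult.assoc diff_diff_eq)
qed

section \<open>Matrix coefficients between the two Whittaker vectors\<close>

definition coef :: "('n, Cq) free_alg \<Rightarrow> 'n Qlat \<Rightarrow> 'n Qlat \<Rightarrow> 'n kfield" where
  "coef x \<beta> \<gamma> = B (\<pi> (extend_scalars x) (\<theta> \<gamma>)) (\<theta>b \<beta>)"

definition J :: "'n Qlat \<Rightarrow> 'n kfield" where
  "J \<beta> = B (\<theta> \<beta>) (\<theta>b \<beta>)"

text \<open>The coefficient at \<beta> of \<open>D\<close> applied to the generating series of
  \<open>J\<close>, written on the root lattice itself; \<open>act_D_gen_series\<close> makes the
  identification.\<close>

definition act_J :: "('n, 'n kfield) diff_op \<Rightarrow> 'n Qlat \<Rightarrow> 'n kfield" where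
  "act_J D \<beta> =
     lin_eval (\<lambda>(\<alpha>, \<mu>). vlam uvar \<mu> * vpow L (\<iota> vroot) (- wt_form L \<mu> (Q_to_P L (\<beta> + \<alpha>))) * J (\<beta> + \<alpha>)) D"

text \<open>
  The sum over \<open>\<gamma>\<close> computes the component of \<open>(x \<theta>, \<theta>b)\<close> at \<open>\<beta>\<close>; it is finite, whereas \<open>\<theta>\<close> itself
  is an infinite sum.
\<close>

definition represents :: "('n, Cq) free_alg \<Rightarrow> ('n, 'n kfield) diff_op \<Rightarrow> bool" where
  "represents x D \<longleftrightarrow> (\<forall>\<beta>. finite {\<gamma>. coef x \<beta> \<gamma> \<noteq> 0} \<and> Sum_any (coef x \<beta>) = act_J D \<beta>)"

text \<open>Additivity of \<open>Sum_any\<close> relies on finite supports, which is why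
  \<open>represents\<close> carries finiteness along.\<close>

lemma represents_add:
  assumes "represents x D" "represents y D'"
  shows "represents (x + y) (D + D')"
  unfolding represents_def
proof (intro allI conjI)
  fix \<beta>
  have c: "coef (x + y) \<beta> = (\<lambda>\<gamma>. coef x \<beta> \<gamma> + coef y \<beta> \<gamma>)"
    by (simp add: fun_eq_iff coef_def extend_scalars_add \<pi>_add B_add)
  have fin: "finite {\<gamma>. coef x \<beta> \<gamma> \<noteq> 0}" "finite {\<gamma>. coef y \<beta> \<gamma> \<noteq> 0}"
    using assms by (simp_all add: represents_def)
  have "{\<gamma>. coef (x + y) \<beta> \<gamma> \<noteq> 0} \<subseteq> {\<gamma>. coef x \<beta> \<gamma> \<noteq> 0} \<union> {\<gamma>. coef y \<beta> \<gamma> \<noteq> 0}"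
    by (auto simp: c)
  then show "finite {\<gamma>. coef (x + y) \<beta> \<gamma> \<noteq> 0}"
    using fin by (meson finite_UnI finite_subset)
  show "Sum_any (coef (x + y) \<beta>) = act_J (D + D') \<beta>"
    using assms by (simp add: c Sum_any.distrib[OF fin] represents_def act_J_def lin_eval_add)
qed

lemma represents_scale:
  assumes "represents x D"
  shows "represents (cst c * x) (dscale (\<iota> c) D)"
  unfolding represents_def
proof (intro allI conjI)
  fix \<beta>
  have c: "coef (cst c * x) \<beta> = (\<lambda>\<gamma>. \<iota> c * coef x \<beta> \<gamma>)"
    by (simp add: fun_eq_iff coef_def extend_scalars_mult extend_scalars_cst \<pi>_mult \<pi>_cst B_sc)
  have fin: "finite {\<gamma>. coef x \<beta> \<gamma> \<noteq> 0}"
    using assms by (simp add: represents_def)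
  then show "finite {\<gamma>. coef (cst c * x) \<beta> \<gamma> \<noteq> 0}"
    by (rule rev_finite_subset) (auto simp: c)
  show "Sum_any (coef (cst c * x) \<beta>) = act_J (dscale (\<iota> c) D) \<beta>"
    using assms
    by (simp add: c Sum_any_right_distrib[OF fin, symmetric] represents_def act_J_def lin_eval_dscale)
qed

text \<open>After extension of scalars the difference lies in the ideal over the larger field and
  acts by zero on the Verma module.\<close>

lemma coef_cong:
  assumes "ueq y x"
  shows "coef y = coef x"
proof -
  have "extend_scalars (y - x) \<in> uq_ideal L (\<iota> vroot)"
    using assms by (simp add: ueq_def extend_scalars_ideal)
  then have "\<pi> (extend_scalars (y - x)) w = 0" for w
    by (rule uq_module_ideal[OF verma_module])
  then have "\<pi> (extend_scalars y) w = \<pi> (extend_scalars x) w" for w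
    using \<pi>_add[of "extend_scalars (y - x)" "extend_scalars x"] by (simp flip: extend_scalars_add)
  then show ?thesis by (simp add: fun_eq_iff coef_def)
qed

lemma represents_supported:
  assumes "\<And>\<beta> \<gamma>. \<gamma> \<noteq> g \<beta> \<Longrightarrow> coef x \<beta> \<gamma> = 0" and "\<And>\<beta>. coef x \<beta> (g \<beta>) = act_J D \<beta>"
  shows "represents x D"
  unfolding represents_def
proof (intro allI conjI)
  fix \<beta>
  have sub: "{\<gamma>. coef x \<beta> \<gamma> \<noteq> 0} \<subseteq> {g \<beta>}"
    using assms(1) by blast
  then show "finite {\<gamma>. coef x \<beta> \<gamma> \<noteq> 0}"
    by (rule finite_subset) simp
  show "Sum_any (coef x \<beta>) = act_J D \<beta>"
    using assms(2) by (subst Sum_any.expand_superset[OF _ sub]) simp_all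
qed

text \<open>The central computation. The e-word lowers \<gamma> by \<open>?e\<close>, the Cartan
  factor gives an eigenvalue, and the f-word crosses the pairing and lowers \<beta> by
  \<open>?f\<close>. Orthogonality forces both lowered indices to agree, and what remains is the
  action of the basis element indexed by \<open>(- ?f, \<mu>)\<close>.\<close>

lemma represents_base:
  "represents (prod_list (map (sev_f nm) js) * gK \<mu> * prod_list (map (sev_e np) is))
     (Poly_Mapping.single (- sum_list (map sroot js), \<mu>) (prod_list (map cm js) * prod_list (map cp is)))"
  (is "represents ?x (Poly_Mapping.single (- ?f, \<mu>) (?cm * ?cp))")
proof (rule represents_supported[where g = "\<lambda>\<beta>. \<beta> - ?f + sum_list (map sroot is)"])
  let ?e = "sum_list (map sroot is)"
  have c: "coef ?x \<beta> \<gamma> = ?cm * ?cp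
      * (vlam uvar \<mu> * vpow L (\<iota> vroot) (- wt_form L \<mu> (Q_to_P L (\<gamma> - ?e)))) * B (\<theta> (\<gamma> - ?e)) (\<theta>b (\<beta> - ?f))"
    for \<beta> \<gamma>
    by (simp add: coef_def extend_scalars_mult extend_scalars_prod_list \<pi>_mult sev_e_word_\<theta> \<pi>_sc
        gK_\<theta> B_sev_f_word B_sc mult.assoc)
  show "coef ?x \<beta> \<gamma> = 0" if "\<gamma> \<noteq> \<beta> - ?f + ?e" for \<beta> \<gamma>
  proof -
    have "\<gamma> - ?e \<noteq> \<beta> - ?f" using that by (simp add: diff_eq_eq)
    then show ?thesis by (simp add: c B_orthogonal)
  qed
  show "coef ?x \<beta> (\<beta> - ?f + ?e) = act_J (Poly_Mapping.single (- ?f, \<mu>) (?cm * ?cp)) \<beta>" for \<beta>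
    unfolding c by (simp add: act_J_def J_def mult.assoc)
qed

lemma act_D_gen_series:
  "act_D L (\<iota> vroot) uvar D (gen_series L 0 J) (Q_to_P L \<beta>) = act_J D \<beta>"
proof -
  have "J \<beta> = 0" if "\<beta> \<notin> Q_plus" for \<beta>
    using whittaker that unfolding whittaker_vector_def by (simp add: J_def B_zero)
  then show ?thesis
    by (simp add: act_D_eq_lin_eval act_J_def gen_series_Q_to_P[OF semisimple] flip: Q_to_P_add)
qed

text \<open>Difference operators shift exponents by the root lattice, so they never move an exponent
  outside it into it.\<close>

lemma act_D_gen_series_off:
  assumes "\<kappa> \<notin> range (Q_to_P L)"
  shows "act_D L q u D (gen_series L 0 J') \<kappa> = 0"
proof -
  have "\<kappa> + Q_to_P L \<alpha> \<notin> range (Q_to_P L)" for \<alpha>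
  proof
    assume "\<kappa> + Q_to_P L \<alpha> \<in> range (Q_to_P L)"
    then obtain \<beta> where "\<kappa> + Q_to_P L \<alpha> = Q_to_P L \<beta>" by blast
    then have "\<kappa> = Q_to_P L (\<beta> - \<alpha>)" by (simp add: Q_to_P_diff eq_diff_eq)
    then show False using assms by simp
  qed
  then show ?thesis
    by (simp add: act_D_eq_lin_eval gen_series_not_in_range lin_eval_def case_prod_unfold)
qed

end

text \<open>Membership is carried through the induction because a character is multiplicative only
  on its subalgebra.\<close>

lemma character_on_word:
  assumes "character_on L (uq_subalg L vroot (Set.range g)) ch" and "\<And>i. ch (g i) = c i"
  shows "prod_list (map g xs) \<in> uq_subalg L vroot (Set.range g)
     \<and> ch (prod_list (map g xs)) = prod_list (map c xs)"
proof (induction xs)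
  case Nil
  have "ch (cst 1) = \<iota> 1"
    using assms(1) unfolding character_on_def by blast
  then show ?case using uq_subalg.const[of 1] by simp
next
  case (Cons x xs)
  have "g x \<in> uq_subalg L vroot (Set.range g)"
    by (rule uq_subalg.gen) simp
  moreover have "ch (x * y) = ch x * ch y"
    if "x \<in> uq_subalg L vroot (Set.range g)" "y \<in> uq_subalg L vroot (Set.range g)" for x y
    using assms(1) that unfolding character_on_def by blast
  ultimately show ?case using Cons assms(2) by (simp add: uq_subalg.mult)
qed

text \<open>Matrix coefficients and the reduction map are both linear and constant on congruence
  classes, so agreement on the spanning products f K e suffices.\<close>

lemma (in whittaker_pair) whittaker_reduction_represents:
  assumes "character_on L (U_plus L np) chp" "\<And>i. chp (sev_e np i) = cp i"
    and "character_on L (U_minus L nm) chm" "\<And>i. chm (sev_f nm i) = cm i"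
    and D: "whittaker_reduction L np chp nm chm D"
  shows "represents x (D x)"
  using triangular_spanning[of x nm np]
proof (induction rule: tri.induct)
  case (base js \<mu> "is")
  let ?f = "prod_list (map (sev_f nm) js)" and ?e = "prod_list (map (sev_e np) is)"
  have e: "?e \<in> U_plus L np" "chp ?e = prod_list (map cp is)"
    using character_on_word[OF assms(1)[unfolded U_plus_def] assms(2)] by (auto simp: U_plus_def)
  have f: "?f \<in> U_minus L nm" "chm ?f = prod_list (map cm js)"
    using character_on_word[OF assms(3)[unfolded U_minus_def] assms(4)] by (auto simp: U_minus_def)
  have "D (?f * gK \<mu> * ?e) = Poly_Mapping.single (- sum_list (map sroot js), \<mu>) (chm ?f * chp ?e)"
    using D e(1) f(1) uq_weight_sev_f_word[of js nm] unfolding whittaker_reduction_def by blast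
  then show ?case using represents_base by (simp add: e f)
next
  case (scale x c)
  have "D (cst c * x) = dscale (\<iota> c) (D x)"
    using D unfolding whittaker_reduction_def by blast
  then show ?case using represents_scale[OF scale.IH] by simp
next
  case (add x y)
  have "D (x + y) = D x + D y"
    using D unfolding whittaker_reduction_def by blast
  then show ?case using represents_add[OF add.IH] by simp
next
  case (ueq x y)
  have "D y = D x"
    using D ueq.hyps(2) unfolding whittaker_reduction_def ueq_def by blast
  then show ?case using ueq.IH by (simp add: represents_def coef_cong[OF ueq.hyps(2)])
qed

theorem theorem4p9:
  fixes L :: "'n::{finite,linorder} lie_data"
    and \<epsilon>p \<epsilon>m np nm :: "'n \<Rightarrow> 'n \<Rightarrow> int"
    and cp cm :: "'n \<Rightarrow> 'n kfield"
    and sc :: "'n kfield \<Rightarrow> 'w::ab_group_add \<Rightarrow> 'w"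
    and \<pi> :: "('n, 'n kfield) free_alg \<Rightarrow> 'w \<Rightarrow> 'w"
    and one :: 'w
    and scb :: "'n kfield \<Rightarrow> 'z::ab_group_add \<Rightarrow> 'z"
    and \<pi>b :: "('n, 'n kfield) free_alg \<Rightarrow> 'z \<Rightarrow> 'z"
    and oneb :: 'z
    and B :: "'w \<Rightarrow> 'z \<Rightarrow> 'n kfield"
    and \<theta> :: "'n Qlat \<Rightarrow> 'w"
    and \<theta>b :: "'n Qlat \<Rightarrow> 'z"
    and chp chm :: "('n, Cq) free_alg \<Rightarrow> 'n kfield"
    and D :: "('n, Cq) free_alg \<Rightarrow> ('n, 'n kfield) diff_op"
    and scV :: "Cq \<Rightarrow> 'x::ab_group_add \<Rightarrow> 'x"
    and \<pi>V :: "('n, Cq) free_alg \<Rightarrow> 'x \<Rightarrow> 'x"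
    and C :: "('n, Cq) free_alg"
    and J :: "'n Qlat \<Rightarrow> 'n kfield"
  assumes "semisimple_data L"
    and "sevostyanov_triple L \<epsilon>p np cp"
    and "sevostyanov_triple L \<epsilon>m nm cm"
    and "universal_verma L (\<iota> vroot) uvar sc \<pi> one"
    and "universal_verma L (inverse (\<iota> vroot)) (\<lambda>i. inverse (uvar i)) scb \<pi>b oneb"
    and "verma_pairing sc \<pi> one scb \<pi>b oneb B"
    and "whittaker_vector L (\<iota> vroot) uvar sc \<pi> one np cp \<theta>"
    and "whittaker_vector L (inverse (\<iota> vroot)) (\<lambda>i. inverse (uvar i)) scb \<pi>b oneb nm cm \<theta>b"
    and "\<And>\<beta>. J \<beta> = B (\<theta> \<beta>) (\<theta>b \<beta>)"
    and "character_on L (U_plus L np) chp" and "\<And>i. chp (sev_e np i) = cp i"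
    and "character_on L (U_minus L nm) chm" and "\<And>i. chm (sev_f nm i) = cm i"
    and "whittaker_reduction L np chp nm chm D"
    and "fd_uq_module L vroot scV \<pi>V"
    and "is_C_V L sc \<pi> scV \<pi>V C"
  shows "act_D L (\<iota> vroot) uvar (D C) (gen_series L 0 J)
           = (\<lambda>\<kappa>. tr_2lam_rho L scV \<pi>V * gen_series L 0 J \<kappa>)
       \<and> act_D L (\<iota> vroot) uvar (rho_conj L (\<iota> vroot) (D C)) (gen_series L \<rho> J)
           = (\<lambda>\<kappa>. tr_2lam_rho L scV \<pi>V * gen_series L \<rho> J \<kappa>)"
proof -
  interpret whittaker_pair L sc \<pi> one scb \<pi>b oneb B np nm cp cm \<theta> \<theta>b
    using assms by unfold_locales (simp_all add: universal_verma_def)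
  let ?t = "tr_2lam_rho L scV \<pi>V"
  have J: "J = local.J"
    using assms(9) by (simp add: fun_eq_iff local.J_def)
  have "represents C (D C)"
    using assms by (intro whittaker_reduction_represents)
  \<comment> \<open>The defining property of \<open>C\<close> is that it acts on the whole Verma
    module by the scalar \<open>?t\<close>.\<close>
  moreover have c: "coef C \<beta> \<gamma> = ?t * B (\<theta> \<gamma>) (\<theta>b \<beta>)" for \<beta> \<gamma>
    using assms(16) by (simp add: is_C_V_def coef_def B_sc)
  moreover have "Sum_any (coef C \<beta>) = ?t * J \<beta>" for \<beta>
  proof -
    have "{\<gamma>. coef C \<beta> \<gamma> \<noteq> 0} \<subseteq> {\<beta>}"
      using B_orthogonal by (auto simp: c)
    then show ?thesis
      by (subst Sum_any.expand_superset[of "{\<beta>}"]) (simp_all add: c assms(9))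
  qed
  \<comment> \<open>Two evaluations of one sum: through the difference operator, and through the
    scalar action, where orthogonality leaves the diagonal term.\<close>
  ultimately have act: "act_J (D C) \<beta> = ?t * J \<beta>" for \<beta>
    by (simp add: represents_def)
  have "J \<beta> = 0" if "\<beta> \<notin> Q_plus" for \<beta>
    using whittaker that unfolding whittaker_vector_def by (simp add: assms(9) B_zero)
  then have a: "act_D L (\<iota> vroot) uvar (D C) (gen_series L 0 J) \<kappa> = ?t * gen_series L 0 J \<kappa>" for \<kappa>
    \<comment> \<open>At exponents in the root lattice this is \<open>act\<close>; elsewhere both
      sides vanish.\<close>
    by (cases "\<kappa> \<in> range (Q_to_P L)")
      (auto simp: J act_D_gen_series act_D_gen_series_off act[unfolded J] gen_series_not_in_range
        gen_series_Q_to_P[OF semisimple])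
  moreover have "act_D L (\<iota> vroot) uvar (rho_conj L (\<iota> vroot) (D C)) (gen_series L \<rho> J) \<kappa> = ?t * gen_series L \<rho> J \<kappa>"
    for \<kappa>
  proof -
    \<comment> \<open>Undoing the translation by \<rho> turns (b) at \<kappa> into (a) at
      \<open>\<kappa> + \<rho>\<close>.\<close>
    have "act_D L (\<iota> vroot) uvar (rho_conj L (\<iota> vroot) (D C)) (gen_series L \<rho> J) \<kappa>
        = act_D L (\<iota> vroot) uvar (D C) (\<lambda>\<kappa>. gen_series L \<rho> J (\<kappa> - \<rho>)) (\<kappa> + \<rho>)"
      by (rule act_D_rho_conj) (simp_all add: integral)
    also have "(\<lambda>\<kappa>. gen_series L \<rho> J (\<kappa> - \<rho>)) = gen_series L 0 J"
      by (simp add: fun_eq_iff gen_series_shift[of L \<rho>])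
    finally show ?thesis by (simp only: a gen_series_shift[of L \<rho> J \<kappa>])
  qed
  ultimately show ?thesis by (simp add: fun_eq_iff)
qed

end
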